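(* Let $\mathcal{G}=(G_n)_{n\ge1}$ be an $\mathrm{Inc}$-invariant chain of graphs with stability index $\mathrm{ind}(\mathcal{G})=r$ and sparsity index $\mathrm{sp}(\mathcal{G})=s$. Assume that $V(G_r)=[r]$ and that $(1,i),(j,r)\in E(G_r)$ for some $i,j\in[r]$. Denote by $\mathrm{Cl}(G_n)$ and $\omega(G_n)$ the clique complex and the clique number of $G_n$, and let $(f_{-1}(\mathrm{Cl}(G_n)),f_0(\mathrm{Cl}(G_n)),\dots)$ and $(h_0(\mathrm{Cl}(G_n)),h_1(\mathrm{Cl}(G_n)),\dots)$ be the $f$-vector and the $h$-vector of $\mathrm{Cl}(G_n)$. Then there exists $n_0\ge r+s$ such that, for every $n\ge n_0$, the following statements hold: (i) The function $n\mapsto\omega(G_n)$ is eventually quasi-linear of period $s$. More precisely, $$\omega(G_n)=\omega(G_{n_0})+\left\lfloor\frac{n-n_0}{s}\right\rfloor.$$ (ii) For every $i\ge0$, $$f_i(\mathrm{Cl}(G_n))=f_i(\mathrm{Cl}(G_{n-1}))+f_{i-1}(\mathrm{Cl}(G_{n-s})).$$ (iii) With the convention $h_{-1}(\mathrm{Cl}(G_k))=0$, one has, for every $i\ge0$, $$h_i(\mathrm{Cl}(G_n))=\begin{cases}h_i(\mathrm{Cl}(G_{n-1}))+h_{i-1}(\mathrm{Cl}(G_{n-s}))&\text{if }s\nmid(n-n_0),\\ h_i(\mathrm{Cl}(G_{n-1}))-h_{i-1}(\mathrm{Cl}(G_{n-1}))+h_{i-1}(\mathrm{Cl}(G_{n-s}))&\text{if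 }s\mid(n-n_0).\end{cases}$$ (iv) The ordinary and reduced Euler characteristics satisfy $$\chi(\mathrm{Cl}(G_n))=\chi(\mathrm{Cl}(G_{n-1}))-\chi(\mathrm{Cl}(G_{n-s}))+1,$$ $$\widetilde{\chi}(\mathrm{Cl}(G_n))=\widetilde{\chi}(\mathrm{Cl}(G_{n-1}))-\widetilde{\chi}(\mathrm{Cl}(G_{n-s})).$$
   Context: $\mathbb{N}$ is the set of positive integers and $[n]=\{1,\dots,n\}$. Graphs are simple and finite, with vertex set contained in $\mathbb{N}$ (possibly empty); an edge $\{i,j\}$ with $i<j$ is written $(i,j)$. $G\subseteq H$ means $V(G)\subseteq V(H)$ and $E(G)\subseteq E(H)$. $\mathrm{Inc}$ is the monoid of strictly increasing maps $\pi:\mathbb{N}\to\mathbb{N}$, and $\mathrm{Inc}_{n,m}=\{\pi\in\mathrm{Inc}\mid\pi(n)\le m\}$ for $n\le m$. For $\Gamma\subseteq\mathrm{Inc}$ and a graph $G$, $\Gamma(G)$ is the graph with vertex set $\bigcup_{\pi\in\Gamma}\pi(V(G))$ and edge set $\{(\pi(i),\pi(j))\mid \pi\in\Gamma,(i,j)\in E(G)\}$. An $\mathrm{Inc}$-invariant chain of graphs is a sequence $(G_n)_{n\ge1}$ of graphs with $V(G_n)\subseteq[n]$ and $\mathrm{Inc}_{n,m}(G_n)\subseteq G_m$ for all $m\ge n\ge1$. Every such chain stabilizes: there is $r\in\mathbb{N}$ with $\mathrm{Inc}_{n,m}(G_n)=G_m$ for all $m\ge n\ge r$; the smallest such $r$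 is the stability index $\mathrm{ind}(\mathcal{G})$. The sparsity index is $\mathrm{sp}(\mathcal{G})=\min\{j-i\mid(i,j)\in E(G_r)\}$, where $r=\mathrm{ind}(\mathcal{G})$. The clique complex $\mathrm{Cl}(G)$ is the simplicial complex on $V(G)$ whose faces are the cliques of $G$; $\omega(G)$ is the maximum size of a clique. For a simplicial complex $\Delta$ of dimension $d-1$, $f_i(\Delta)$ is the number of faces with $i+1$ elements ($f_{-1}=1$, and $f_i=0$ for $i\ge d$), and the $h$-vector is given by $h_j(\Delta)=\sum_{i=0}^j(-1)^{j-i}\binom{d-i}{j-i}f_{i-1}(\Delta)$ for $0\le j\le d$, with $h_j=0$ for $j>d$. The Euler characteristic is $\chi(\Delta)=\sum_{i\ge0}(-1)^if_i(\Delta)$ and $\widetilde\chi(\Delta)=\chi(\Delta)-1$. A function $\psi:\mathbb{N}\to\mathbb{Q}$ is quasi-polynomial if there are $N\in\mathbb{N}$ (a quasiperiod) and polynomials $P_0,\dots,P_{N-1}\in\mathbb{Q}[t]$ with $\psi(n)=P_k(n)$ whenever $n\equiv k\pmod N$; the smallest quasiperiod is the period, and the degree is $\max_k\deg P_k$. Quasi-linear means quasi-polynomial of degree $1$. "Eventually" means that the function agrees with such a function for all sufficiently large $n$. *)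

theory Defs
  imports
    Complex_Main
    "HOL-Library.Ramsey"
    "HOL-Computational_Algebra.Polynomial"
begin

section \<open>Graphs on positive integers\<close>

text \<open>
  An edge is a two-element set; the pair notation \<open>(i, j)\<close> with \<open>i < j\<close> stands for the edge
  \<open>{i, j}\<close>. The set of positive integers is \<open>{1..} :: nat set\<close>.
\<close>

record ngraph =
  vertices :: "nat set"
  edges :: "nat set set"

definition is_graph :: "ngraph \<Rightarrow> bool" where
  "is_graph G \<longleftrightarrow> vertices G \<subseteq> {1..} \<and> finite (vertices G) \<and> edges G \<subseteq> [vertices G]\<^bsup>2\<^esup>"

definition subgraph_of :: "ngraph \<Rightarrow> ngraph \<Rightarrow> bool" where
  "subgraph_of G H \<longleftrightarrow> vertices G \<subseteq> vertices H \<and> edges G \<subseteq> edges H"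

section \<open>Chains of graphs invariant under increasing maps\<close>

text \<open>
  Increasing maps of the positive integers are functions on \<open>nat\<close> restricted to \<open>{1..}\<close>;
  their value at \<open>0\<close> is arbitrary and never used.
\<close>

definition Inc :: "(nat \<Rightarrow> nat) set" where
  "Inc = {\<pi>. strict_mono_on {1..} \<pi> \<and> \<pi> ` {1..} \<subseteq> {1..}}"

definition Inc_between :: "nat \<Rightarrow> nat \<Rightarrow> (nat \<Rightarrow> nat) set" where
  "Inc_between n m = {\<pi> \<in> Inc. \<pi> n \<le> m}"

definition orbit_graph :: "(nat \<Rightarrow> nat) set \<Rightarrow> ngraph \<Rightarrow> ngraph" where
  "orbit_graph \<Gamma> G =
    \<lparr>vertices = (\<Union>\<pi>\<in>\<Gamma>. \<pi> ` vertices G),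
     edges = {\<pi> ` e | \<pi> e. \<pi> \<in> \<Gamma> \<and> e \<in> edges G}\<rparr>"

text \<open>A chain is indexed by the positive integers; its value at \<open>0\<close> is arbitrary.\<close>

definition Inc_invariant_chain :: "(nat \<Rightarrow> ngraph) \<Rightarrow> bool" where
  "Inc_invariant_chain G \<longleftrightarrow>
    (\<forall>n\<ge>1. is_graph (G n) \<and> vertices (G n) \<subseteq> {1..n}) \<and>
    (\<forall>n\<ge>1. \<forall>m\<ge>n. subgraph_of (orbit_graph (Inc_between n m) (G n)) (G m))"

text \<open>Every \<^const>\<open>Inc_invariant_chain\<close> stabilizes, so the minimum below is attained.\<close>

definition stability_index :: "(nat \<Rightarrow> ngraph) \<Rightarrow> nat" where
  "stability_index G =
    (LEAST r. r \<ge> 1 \<and> (\<forall>n\<ge>r. \<forall>m\<ge>n. orbit_graph (Inc_between n m) (G n) = G m))"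

definition sparsity_index :: "(nat \<Rightarrow> ngraph) \<Rightarrow> nat" where
  "sparsity_index G = Min {j - i | i j. i < j \<and> {i, j} \<in> edges (G (stability_index G))}"

section \<open>Clique complexes and face numbers\<close>

definition clique_complex :: "ngraph \<Rightarrow> nat set set" where
  "clique_complex G = {C. C \<subseteq> vertices G \<and> clique C (edges G)}"

definition clique_number :: "ngraph \<Rightarrow> nat" where
  "clique_number G = Max {card C | C. C \<subseteq> vertices G \<and> clique C (edges G)}"

text \<open>
  A finite simplicial complex is given by its set of faces, the empty face included.
  Indices of face numbers and of the h-vector are integers, to allow for \<open>-1\<close>.
\<close>

definition complex_dim :: "'a set set \<Rightarrow> int" where
  "complex_dim \<Delta> = int (Max (card ` \<Delta>)) - 1"

definition f_number :: "'a set set \<Rightarrow> int \<Rightarrow> nat" where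
  "f_number \<Delta> i = card {F \<in> \<Delta>. int (card F) = i + 1}"

definition h_number :: "'a set set \<Rightarrow> int \<Rightarrow> int" where
  "h_number \<Delta> j =
    (let d = nat (complex_dim \<Delta> + 1) in
      if j < 0 \<or> j > int d then 0
      else (\<Sum>i = 0..nat j. (-1) ^ (nat j - i) * int ((d - i) choose (nat j - i)) *
              int (f_number \<Delta> (int i - 1))))"

text \<open>The sum may stop at the dimension, since all further face numbers vanish.\<close>

definition euler_char :: "'a set set \<Rightarrow> int" where
  "euler_char \<Delta> = (\<Sum>i < nat (complex_dim \<Delta> + 1). (-1) ^ i * int (f_number \<Delta> (int i)))"

definition reduced_euler_char :: "'a set set \<Rightarrow> int" where
  "reduced_euler_char \<Delta> = euler_char \<Delta> - 1"

section \<open>Quasi-polynomials\<close>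

text \<open>
  Functions on the positive integers are functions on \<open>nat\<close> whose value at \<open>0\<close> is disregarded.
  The constituent polynomials are determined by the function and the quasiperiod, and the maximum
  of their degrees does not depend on the quasiperiod.
\<close>

definition qp_representation :: "(nat \<Rightarrow> rat) \<Rightarrow> nat \<Rightarrow> (nat \<Rightarrow> rat poly) \<Rightarrow> bool" where
  "qp_representation \<psi> N P \<longleftrightarrow>
    N \<ge> 1 \<and> (\<forall>n\<ge>1. \<psi> n = poly (P (n mod N)) (of_nat n))"

definition qp_period :: "(nat \<Rightarrow> rat) \<Rightarrow> nat" where
  "qp_period \<psi> = (LEAST N. \<exists>P. qp_representation \<psi> N P)"

definition quasi_linear :: "(nat \<Rightarrow> rat) \<Rightarrow> bool" where
  "quasi_linear \<psi> \<longleftrightarrow>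
    (\<exists>N P. qp_representation \<psi> N P \<and> (MAX k\<in>{..<N}. degree (P k)) = 1)"

definition eventually_quasi_linear_of_period :: "(nat \<Rightarrow> rat) \<Rightarrow> nat \<Rightarrow> bool" where
  "eventually_quasi_linear_of_period \<phi> s \<longleftrightarrow>
    (\<exists>\<psi>. quasi_linear \<psi> \<and> qp_period \<psi> = s \<and> (\<forall>\<^sub>F n in sequentially. \<phi> n = \<psi> n))"

end

theory Submission
  imports Defs
begin

text \<open>
  An edge \<open>{i, j}\<close> of \<open>G n\<close> with \<open>i < j\<close> is recorded by the triple of distances \<open>(i, j - i, n - j)\<close>.
  Increasing maps turn such a triple into an arbitrary dominating one, so Dickson's lemma shows that the
  chain stabilizes (\<open>chain_stabilizes\<close>), and for \<open>n \<ge> r\<close> the edges of \<open>G n\<close> are exactly the pairs whose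
  triple dominates that of an edge of \<open>G r\<close> (\<open>chain_graph_above_stability\<close>). Since \<open>G r\<close> has
  an edge at \<open>1\<close>, a vertex \<open>y\<close> far from both ends of \<open>{1..n}\<close> is joined to the vertices on its left as
  simply as possible: \<open>y\<close> is adjacent to \<open>x < y\<close> if and only if \<open>x \<le> y - s\<close>
  (\<open>adj_inf_iff_gap\<close>). Symmetrically, the edge at \<open>r\<close> ensures that every vertex close to \<open>n\<close> is joined
  to all vertices in the middle from some bounded distance on (\<open>adj_start_end\<close>).

  The heart of the proof is the recurrence for the number of cliques. Fix the trace of a clique on the
  last \<open>r\<close> vertices and record it by the set \<open>B\<close> of distances to \<open>n\<close>. The rest of the clique is then a set
  \<open>D \<subseteq> {1..y}\<close> with \<open>y = n - margin B\<close>, subject to conditions that involve neither \<open>n\<close> nor \<open>y\<close>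
  (\<open>clique_split_iff\<close>). Either \<open>y\<close> is not in \<open>D\<close>, and \<open>D \<subseteq> {1..y - 1}\<close>, or it is, and the
  remaining elements form such a set in \<open>{1..y - s}\<close>. Summing over \<open>B\<close> gives
  \<open>f_i(n) = f_i(n - 1) + f_{i-1}(n - s)\<close> (\<open>clique_count_Suc\<close>).

  Everything else follows from this recurrence for the face polynomials, \<open>F_n = F_{n-1} + t F_{n-s}\<close>.
  Comparing degrees, \<open>\<omega>(n) = max (\<omega>(n - 1)) (\<omega>(n - s) + 1)\<close>; together with the bound
  \<open>\<omega>(n) \<le> n div s + 1\<close> this forces \<open>\<omega>\<close> to become a staircase that rises by one every \<open>s\<close> steps
  (\<open>recurrence_eventually_staircase\<close>), and \<open>n0\<close> is a point where it rises. The h-polynomial is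
  \<open>(1 - t)^\<omega> F(t / (1 - t))\<close>, so the recurrence carries over to it, with an additional factor \<open>1 - t\<close> on
  the term of index \<open>n - 1\<close> exactly when \<open>\<omega>(n) = \<omega>(n - 1) + 1\<close>, that is, when \<open>s\<close> divides
  \<open>n - n0\<close>. The reduced Euler characteristic is \<open>- F(-1)\<close>.
\<close>

section \<open>Dickson's lemma\<close>

lemma nat_seq_nondecreasing_subseq:
  fixes f :: "nat \<Rightarrow> nat"
  shows "\<exists>g::nat \<Rightarrow> nat. strict_mono g \<and> mono (f \<circ> g)"
proof -
  obtain g :: "nat \<Rightarrow> nat" where g: "strict_mono g" "monoseq (\<lambda>n. f (g n))"
    using seq_monosub by blast
  show ?thesis
  proof (cases "incseq (\<lambda>n. f (g n))")
    case True
    then show ?thesis using g(1) by (auto simp: o_def)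
  next
    case False
    then have dec: "decseq (\<lambda>n. f (g n))"
      using g(2) by (simp add: monoseq_iff)
    \<comment> \<open>A nonincreasing sequence of naturals is constant from its minimum on.\<close>
    obtain K where K: "\<And>k. f (g K) \<le> f (g k)"
      using ex_has_least_nat[of "\<lambda>_. True" _ "\<lambda>k. f (g k)"] by auto
    have const: "f (g (k + K)) = f (g K)" for k
      using K[of "k + K"] decseqD[OF dec, of K "k + K"] by simp
    have "strict_mono (\<lambda>k. g (k + K))"
      using g(1) by (simp add: strict_mono_def)
    moreover have "mono (f \<circ> (\<lambda>k. g (k + K)))"
      using const by (simp add: mono_def)
    ultimately show ?thesis by blast
  qed
qed

lemma common_nondecreasing_subseq:
  fixes p :: "nat \<Rightarrow> 'a" and F :: "('a \<Rightarrow> nat) set"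
  assumes "finite F"
  shows "\<exists>g::nat \<Rightarrow> nat. strict_mono g \<and> (\<forall>f\<in>F. mono (\<lambda>k. f (p (g k))))"
  using assms
proof (induction F)
  case empty
  then show ?case using strict_mono_id by (auto intro!: exI[of _ id])
next
  case (insert f F)
  then obtain g :: "nat \<Rightarrow> nat"
    where g: "strict_mono g" "\<And>f'. f' \<in> F \<Longrightarrow> mono (\<lambda>k. f' (p (g k)))" by blast
  obtain h :: "nat \<Rightarrow> nat" where h: "strict_mono h" "mono ((\<lambda>k. f (p (g k))) \<circ> h)"
    using nat_seq_nondecreasing_subseq by blast
  have "strict_mono (\<lambda>k. g (h k))"
    using g(1) h(1) by (simp add: strict_mono_def)
  moreover have "mono (\<lambda>k. f' (p (g (h k))))" if "f' \<in> F" for f'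
    using g(2)[OF that] strict_mono_mono[OF h(1)] by (simp add: mono_def)
  moreover have "mono (\<lambda>k. f (p (g (h k))))"
    using h(2) by (simp add: o_def)
  ultimately show ?case by (auto intro!: exI[of _ "\<lambda>k. g (h k)"])
qed

text \<open>
  The functions in \<open>F\<close> play the role of coordinates. If no bound \<open>R\<close> worked, each \<open>R\<close> would have a
  point \<open>p R\<close> that dominates no point of \<open>P\<close> of size at most \<open>R\<close>; but along a subsequence on which all
  coordinates are nondecreasing, late terms dominate the first one, whose size is fixed.
\<close>

lemma Dickson_bounded_below:
  fixes P :: "'a set" and F :: "('a \<Rightarrow> nat) set" and size :: "'a \<Rightarrow> nat"
  assumes "finite F"
  shows "\<exists>R. \<forall>p\<in>P. \<exists>q\<in>P. size q \<le> R \<and> (\<forall>f\<in>F. f q \<le> f p)"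
proof (rule ccontr)
  assume "\<not> ?thesis"
  then have "\<forall>R. \<exists>p\<in>P. \<forall>q\<in>P. size q \<le> R \<longrightarrow> \<not> (\<forall>f\<in>F. f q \<le> f p)" by meson
  then obtain p where p: "\<And>R. p R \<in> P"
    "\<And>R q. q \<in> P \<Longrightarrow> size q \<le> R \<Longrightarrow> \<not> (\<forall>f\<in>F. f q \<le> f (p R))" by metis
  obtain g :: "nat \<Rightarrow> nat"
    where g: "strict_mono g" "\<And>f. f \<in> F \<Longrightarrow> mono (\<lambda>k. f (p (g k)))"
    using common_nondecreasing_subseq[OF assms] by metis
  define l where "l = size (p (g 0))"
  have "l \<le> g l" using g(1) by (rule strict_mono_imp_increasing)
  moreover have "f (p (g 0)) \<le> f (p (g l))" if "f \<in> F" for f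
    using g(2)[OF that] by (simp add: mono_def)
  ultimately show False using p(1) p(2)[of "p (g 0)" "g l"] by (auto simp: l_def)
qed

section \<open>Increasing maps and the stabilization of chains\<close>

lemma Inc_shift:
  assumes "\<pi> \<in> Inc" "1 \<le> x" "x \<le> y"
  shows "\<pi> x + y \<le> \<pi> y + x"
  using assms(3)
proof (induction y rule: dec_induct)
  case base
  then show ?case by simp
next
  case (step y)
  have "\<pi> y < \<pi> (Suc y)"
    using assms(1,2) step(1) unfolding Inc_def by (auto intro: strict_mono_onD)
  then show ?case using step by simp
qed

lemma Inc_ge:
  assumes "\<pi> \<in> Inc" "1 \<le> x"
  shows "x \<le> \<pi> x"
proof -
  have "1 \<le> \<pi> 1" using assms(1) unfolding Inc_def by auto
  then show ?thesis using Inc_shift[OF assms(1), of 1 x] assms(2) by simp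
qed

text \<open>
  In terms of the triple \<open>(i, j - i, n - j)\<close> of the distances between \<open>0\<close>, \<open>i\<close>, \<open>j\<close> and \<open>n\<close>, an
  increasing map can stretch each of the three distances freely but shrink none of them. The inequalities
  are written additively because subtraction truncates; the degenerate pair \<open>i = j\<close> yields the
  corresponding fact for a single vertex.
\<close>

lemma Inc_between_pair_iff:
  assumes "1 \<le> i" "i \<le> j" "j \<le> n"
  shows "(\<exists>\<pi>\<in>Inc_between n m. \<pi> i = i' \<and> \<pi> j = j') \<longleftrightarrow>
    i \<le> i' \<and> i' + j \<le> j' + i \<and> j' + n \<le> m + j \<and> (i = j \<longrightarrow> i' = j')"
proof
  assume "\<exists>\<pi>\<in>Inc_between n m. \<pi> i = i' \<and> \<pi> j = j'"
  then obtain \<pi> where \<pi>: "\<pi> \<in> Inc" "\<pi> n \<le> m" "\<pi> i = i'" "\<pi> j = j'"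
    unfolding Inc_between_def by blast
  show "i \<le> i' \<and> i' + j \<le> j' + i \<and> j' + n \<le> m + j \<and> (i = j \<longrightarrow> i' = j')"
    using Inc_ge[OF \<pi>(1), of i] Inc_shift[OF \<pi>(1), of i j] Inc_shift[OF \<pi>(1), of j n] \<pi> assms
    by auto
next
  assume *: "i \<le> i' \<and> i' + j \<le> j' + i \<and> j' + n \<le> m + j \<and> (i = j \<longrightarrow> i' = j')"
  \<comment> \<open>Translating three blocks by nondecreasing amounts stretches exactly the prescribed distances.\<close>
  define \<pi> where "\<pi> x = (if x < i then x else if x < j then x + (i' - i) else x + (j' - j))" for x
  have "\<pi> \<in> Inc" using * assms unfolding Inc_def
    by (auto simp: \<pi>_def strict_mono_on_def)
  moreover have "\<pi> n \<le> m" "\<pi> i = i'" "\<pi> j = j'" using * assms by (auto simp: \<pi>_def)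
  ultimately show "\<exists>\<pi>\<in>Inc_between n m. \<pi> i = i' \<and> \<pi> j = j'"
    unfolding Inc_between_def by blast
qed

lemma Inc_between_vertex_iff:
  assumes "1 \<le> i" "i \<le> n"
  shows "(\<exists>\<pi>\<in>Inc_between n m. \<pi> i = i') \<longleftrightarrow> i \<le> i' \<and> i' + n \<le> m + i"
  using Inc_between_pair_iff[of i i n m i' i'] assms by auto

lemma is_graph_edgeE:
  assumes "is_graph H" "e \<in> edges H"
  obtains i j where "i < j" "e = {i, j}" "i \<in> vertices H" "j \<in> vertices H" "1 \<le> i"
proof -
  have "e \<subseteq> vertices H" "card e = 2" "vertices H \<subseteq> {1..}"
    using assms by (auto simp: is_graph_def nsets_def)
  then obtain x y where xy: "e = {x, y}" "x \<noteq> y" by (meson card_2_iff)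
  show thesis
  proof (cases "x < y")
    case True
    then show thesis using that[of x y] xy \<open>e \<subseteq> _\<close> \<open>vertices H \<subseteq> _\<close> by auto
  next
    case False
    then show thesis using that[of y x] xy \<open>e \<subseteq> _\<close> \<open>vertices H \<subseteq> _\<close> by auto
  qed
qed

lemma in_vertices_orbit_iff:
  assumes "vertices H \<subseteq> {1..n}"
  shows "v \<in> vertices (orbit_graph (Inc_between n m) H) \<longleftrightarrow>
    (\<exists>i\<in>vertices H. i \<le> v \<and> v + n \<le> m + i)"
proof -
  have "v \<in> vertices (orbit_graph (Inc_between n m) H) \<longleftrightarrow>
      (\<exists>i\<in>vertices H. \<exists>\<pi>\<in>Inc_between n m. \<pi> i = v)"
    by (auto simp: orbit_graph_def)
  also have "\<dots> \<longleftrightarrow> (\<exists>i\<in>vertices H. i \<le> v \<and> v + n \<le> m + i)"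
    using assms by (intro bex_cong refl Inc_between_vertex_iff) auto
  finally show ?thesis .
qed

lemma in_edges_orbit_iff:
  assumes H: "is_graph H" "vertices H \<subseteq> {1..n}" and lt: "i' < j'"
  shows "{i', j'} \<in> edges (orbit_graph (Inc_between n m) H) \<longleftrightarrow>
    (\<exists>i j. i < j \<and> {i, j} \<in> edges H \<and> i \<le> i' \<and> i' + j \<le> j' + i \<and> j' + n \<le> m + j)"
    (is "_ \<longleftrightarrow> ?R")
proof
  assume "{i', j'} \<in> edges (orbit_graph (Inc_between n m) H)"
  then obtain \<pi> e where \<pi>: "\<pi> \<in> Inc_between n m" "e \<in> edges H" "{i', j'} = \<pi> ` e"
    by (auto simp: orbit_graph_def)
  obtain i j where ij: "i < j" "e = {i, j}" "i \<in> vertices H" "j \<in> vertices H" "1 \<le> i"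
    using is_graph_edgeE[OF H(1) \<pi>(2)] .
  have "\<pi> i < \<pi> j" using \<pi>(1) ij by (auto simp: Inc_between_def Inc_def strict_mono_on_def)
  then have "\<pi> i = i' \<and> \<pi> j = j'" using \<pi>(3) ij(2) lt by (auto simp: doubleton_eq_iff)
  moreover have "i \<le> j" "j \<le> n" using ij H(2) by auto
  ultimately have "i \<le> i' \<and> i' + j \<le> j' + i \<and> j' + n \<le> m + j"
    using Inc_between_pair_iff[of i j n m i' j'] \<pi>(1) ij(5) by blast
  then show ?R using ij \<pi>(2) by blast
next
  assume ?R
  then obtain i j where ij: "i < j" "{i, j} \<in> edges H" "i \<le> i' \<and> i' + j \<le> j' + i \<and> j' + n \<le> m + j"
    by blast
  have "i \<in> vertices H" "j \<in> vertices H" using H(1) ij(2) by (auto simp: is_graph_def nsets_def)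
  then have "1 \<le> i" "i \<le> j" "j \<le> n" using ij(1) H(2) by auto
  then obtain \<pi> where "\<pi> \<in> Inc_between n m" "\<pi> i = i'" "\<pi> j = j'"
    using Inc_between_pair_iff[of i j n m i' j'] ij by blast
  then show "{i', j'} \<in> edges (orbit_graph (Inc_between n m) H)"
    using ij(2) by (auto simp: orbit_graph_def intro!: exI[of _ \<pi>] exI[of _ "{i, j}"])
qed

text \<open>
  Dominating triples with prescribed coordinate sum: this is what lets a generator of index at most \<open>n\<close>
  reach index \<open>m\<close> by passing through index \<open>n\<close>.
\<close>

lemma intermediate_triple:
  fixes a b c x y z N :: nat
  assumes "a \<le> x" "b \<le> y" "c \<le> z" "a + b + c \<le> N" "N \<le> x + y + z"
  shows "\<exists>u v w. a \<le> u \<and> u \<le> x \<and> b \<le> v \<and> v \<le> y \<and> c \<le> w \<and> w \<le> z \<and> u + v + w = N"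
proof -
  \<comment> \<open>Raise the first coordinate as far as possible, then the second; the third takes the rest.\<close>
  define u where "u = min x (N - b - c)"
  define v where "v = min y (N - u - c)"
  show ?thesis
    by (rule exI[of _ u], rule exI[of _ v], rule exI[of _ "N - u - v"])
      (use assms in \<open>auto simp: u_def v_def min_def split: if_splits\<close>)
qed

lemma chain_graphD:
  assumes "Inc_invariant_chain G" "1 \<le> n"
  shows "is_graph (G n)" "vertices (G n) \<subseteq> {1..n}"
  using assms by (auto simp: Inc_invariant_chain_def)

lemma chain_orbit_subset:
  assumes "Inc_invariant_chain G" "1 \<le> n" "n \<le> m"
  shows "subgraph_of (orbit_graph (Inc_between n m) (G n)) (G m)"
  using assms by (auto simp: Inc_invariant_chain_def)

lemma chain_edge_shift:
  assumes chain: "Inc_invariant_chain G" and "1 \<le> n" "n \<le> m" "i < j" "{i, j} \<in> edges (G n)"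
    and "i \<le> i'" "i' + j \<le> j' + i" "j' + n \<le> m + j"
  shows "{i', j'} \<in> edges (G m)"
proof -
  have "i' < j'" using assms by linarith
  then have "{i', j'} \<in> edges (orbit_graph (Inc_between n m) (G n))"
    using in_edges_orbit_iff[OF chain_graphD[OF chain \<open>1 \<le> n\<close>]] assms by blast
  then show ?thesis using chain_orbit_subset[OF chain, of n m] assms by (auto simp: subgraph_of_def)
qed

lemma chain_vertex_shift:
  assumes chain: "Inc_invariant_chain G" and "1 \<le> n" "n \<le> m" "i \<in> vertices (G n)"
    and "i \<le> i'" "i' + n \<le> m + i"
  shows "i' \<in> vertices (G m)"
proof -
  have "i' \<in> vertices (orbit_graph (Inc_between n m) (G n))"
    using in_vertices_orbit_iff[OF chain_graphD(2)[OF chain \<open>1 \<le> n\<close>]] assms by blast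
  then show ?thesis using chain_orbit_subset[OF chain, of n m] assms by (auto simp: subgraph_of_def)
qed

text \<open>
  The argument is that for edges below, with the pair \<open>(i, n - i)\<close> in place of the triple.
\<close>

lemma chain_vertices_stabilize:
  assumes chain: "Inc_invariant_chain G"
  shows "\<exists>R. \<forall>n m. R \<le> n \<longrightarrow> 1 \<le> n \<longrightarrow> n \<le> m \<longrightarrow>
    vertices (G m) \<subseteq> vertices (orbit_graph (Inc_between n m) (G n))"
proof -
  define P where "P = {(i, n). 1 \<le> n \<and> i \<in> vertices (G n)}"
  have "\<exists>R. \<forall>p\<in>P. \<exists>q\<in>P. snd q \<le> R \<and> (\<forall>f\<in>{fst, \<lambda>(i, n). n - i}. f q \<le> f p)"
    by (rule Dickson_bounded_below) simp
  then obtain R where R: "\<And>p. p \<in> P \<Longrightarrow> \<exists>q\<in>P. snd q \<le> R \<and> (\<forall>f\<in>{fst, \<lambda>(i, n). n - i}. f q \<le> f p)"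
    by blast
  have "v \<in> vertices (orbit_graph (Inc_between n m) (G n))"
    if n: "R \<le> n" "1 \<le> n" "n \<le> m" and v: "v \<in> vertices (G m)" for n m v
  proof -
    have "(v, m) \<in> P" using n v by (simp add: P_def)
    then obtain a n' where q: "(a, n') \<in> P" "n' \<le> R" "a \<le> v" "n' - a \<le> m - v"
    proof -
      obtain q where "q \<in> P" "snd q \<le> R" "\<forall>f\<in>{fst, \<lambda>(i, n). n - i}. f q \<le> f (v, m)"
        using R[OF \<open>(v, m) \<in> P\<close>] by blast
      then show thesis using that[of "fst q" "snd q"] by (simp add: case_prod_unfold)
    qed
    have n': "1 \<le> n'" "a \<in> vertices (G n')" using q(1) by (auto simp: P_def)
    have "a \<in> {1..n'}" using chain_graphD(2)[OF chain n'(1)] n'(2) by blast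
    moreover have "v \<in> {1..m}" using chain_graphD(2)[OF chain, of m] v n by force
    ultimately obtain u w t where u: "a \<le> u" "u \<le> v" "n' - a \<le> w" "w \<le> m - v" "u + t + w = n" "t = 0"
      using intermediate_triple[of a v 0 0 "n' - a" "m - v" n] n q by auto
    have "u \<in> vertices (G n)"
      by (rule chain_vertex_shift[OF chain n'(1) _ n'(2)]) (use u q n in auto)
    then show ?thesis
      using in_vertices_orbit_iff[OF chain_graphD(2)[OF chain \<open>1 \<le> n\<close>]] u \<open>v \<in> {1..m}\<close> by force
  qed
  then show ?thesis by blast
qed

text \<open>
  Dickson's lemma for the triples \<open>(i, j - i, n - j)\<close> bounds the index \<open>n'\<close> of the generators. For
  \<open>R \<le> n \<le> m\<close> an edge of \<open>G m\<close> dominates a generator, and an intermediate triple of coordinate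
  sum \<open>n\<close> is an edge of \<open>G n\<close> that maps to it.
\<close>

lemma chain_edges_stabilize:
  assumes chain: "Inc_invariant_chain G"
  shows "\<exists>R. \<forall>n m. R \<le> n \<longrightarrow> 1 \<le> n \<longrightarrow> n \<le> m \<longrightarrow>
    edges (G m) \<subseteq> edges (orbit_graph (Inc_between n m) (G n))"
proof -
  define P where "P = {(i, j, n). 1 \<le> n \<and> i < j \<and> {i, j} \<in> edges (G n)}"
  let ?F = "{\<lambda>(i, j, n). i, \<lambda>(i, j, n). j - i, \<lambda>(i, j, n). n - j}"
  have "\<exists>R. \<forall>p\<in>P. \<exists>q\<in>P. snd (snd q) \<le> R \<and> (\<forall>f\<in>?F. f q \<le> f p)"
    by (rule Dickson_bounded_below) simp
  then obtain R where R: "\<And>p. p \<in> P \<Longrightarrow> \<exists>q\<in>P. snd (snd q) \<le> R \<and> (\<forall>f\<in>?F. f q \<le> f p)"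
    by blast
  have "e \<in> edges (orbit_graph (Inc_between n m) (G n))"
    if n: "R \<le> n" "1 \<le> n" "n \<le> m" and e: "e \<in> edges (G m)" for n m e
  proof -
    have "1 \<le> m" using n by simp
    then obtain i' j' where e': "i' < j'" "e = {i', j'}" "i' \<in> vertices (G m)" "j' \<in> vertices (G m)"
      using is_graph_edgeE[OF chain_graphD(1)[OF chain \<open>1 \<le> m\<close>] e] by blast
    have m: "1 \<le> i'" "j' \<le> m" using chain_graphD(2)[OF chain \<open>1 \<le> m\<close>] e'(3,4) by auto
    have "(i', j', m) \<in> P" using n e e' by (simp add: P_def)
    then obtain a b n' where q: "(a, b, n') \<in> P" "n' \<le> R" "a \<le> i'" "b - a \<le> j' - i'" "n' - b \<le> m - j'"
    proof -
      obtain q where "q \<in> P" "snd (snd q) \<le> R" "\<forall>f\<in>?F. f q \<le> f (i', j', m)"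
        using R[OF \<open>(i', j', m) \<in> P\<close>] by blast
      then show thesis using that[of "fst q" "fst (snd q)" "snd (snd q)"]
        by (simp add: case_prod_unfold)
    qed
    have n': "1 \<le> n'" "a < b" "{a, b} \<in> edges (G n')" using q(1) by (auto simp: P_def)
    have "b \<in> vertices (G n')"
      using chain_graphD(1)[OF chain n'(1)] n'(3) by (auto simp: is_graph_def nsets_def)
    then have b: "b \<le> n'" using chain_graphD(2)[OF chain n'(1)] by auto
    obtain u v w where u: "a \<le> u" "u \<le> i'" "b - a \<le> v" "v \<le> j' - i'" "n' - b \<le> w" "w \<le> m - j'"
      "u + v + w = n"
      using intermediate_triple[of a i' "b - a" "j' - i'" "n' - b" "m - j'" n] n q n' b e' m by auto
    have "{u, u + v} \<in> edges (G n)"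
      by (rule chain_edge_shift[OF chain n'(1) _ n'(2,3)]) (use u q n n' b in auto)
    then have "\<exists>i j. i < j \<and> {i, j} \<in> edges (G n) \<and> i \<le> i' \<and> i' + j \<le> j' + i \<and> j' + n \<le> m + j"
      using u n' e'(1) m by (intro exI[of _ u] exI[of _ "u + v"]) auto
    then show ?thesis
      using in_edges_orbit_iff[OF chain_graphD[OF chain \<open>1 \<le> n\<close>] e'(1)] e'(2) by blast
  qed
  then show ?thesis by blast
qed

lemma chain_stabilizes:
  assumes chain: "Inc_invariant_chain G"
  shows "\<exists>r\<ge>1. \<forall>n\<ge>r. \<forall>m\<ge>n. orbit_graph (Inc_between n m) (G n) = G m"
proof -
  obtain R1 where R1: "\<And>n m. R1 \<le> n \<Longrightarrow> 1 \<le> n \<Longrightarrow> n \<le> m \<Longrightarrow>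
    vertices (G m) \<subseteq> vertices (orbit_graph (Inc_between n m) (G n))"
    using chain_vertices_stabilize[OF chain] by blast
  obtain R2 where R2: "\<And>n m. R2 \<le> n \<Longrightarrow> 1 \<le> n \<Longrightarrow> n \<le> m \<Longrightarrow>
    edges (G m) \<subseteq> edges (orbit_graph (Inc_between n m) (G n))"
    using chain_edges_stabilize[OF chain] by blast
  have "orbit_graph (Inc_between n m) (G n) = G m" if "max 1 (max R1 R2) \<le> n" "n \<le> m" for n m
    using R1[of n m] R2[of n m] chain_orbit_subset[OF chain, of n m] that
    by (intro ngraph.equality) (auto simp: subgraph_of_def)
  then show ?thesis by (intro exI[of _ "max 1 (max R1 R2)"]) auto
qed

text \<open>
  Only the existence of a stable index makes the minimum in the definition of the stability index
  meaningful.
\<close>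

lemma stability_index_orbit:
  assumes "Inc_invariant_chain G"
  shows "1 \<le> stability_index G"
    and "stability_index G \<le> n \<Longrightarrow> orbit_graph (Inc_between (stability_index G) n) (G (stability_index G)) = G n"
proof -
  have "1 \<le> stability_index G \<and>
    (\<forall>n\<ge>stability_index G. \<forall>m\<ge>n. orbit_graph (Inc_between n m) (G n) = G m)"
    unfolding stability_index_def by (rule LeastI_ex[OF chain_stabilizes[OF assms]])
  then show "1 \<le> stability_index G"
    and "stability_index G \<le> n \<Longrightarrow> orbit_graph (Inc_between (stability_index G) n) (G (stability_index G)) = G n"
    by auto
qed

section \<open>Complexes whose face numbers satisfy a two-term recurrence\<close>

definition face_count :: "'a set set \<Rightarrow> nat \<Rightarrow> nat" where
  "face_count \<Delta> k = card {F \<in> \<Delta>. card F = k}"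

definition max_face_card :: "'a set set \<Rightarrow> nat" where
  "max_face_card \<Delta> = Max (card ` \<Delta>)"

lemma f_number_eq_face_count: "f_number \<Delta> (int k - 1) = face_count \<Delta> k"
  by (simp add: f_number_def face_count_def)

lemma complex_dim_eq: "complex_dim \<Delta> = int (max_face_card \<Delta>) - 1"
  by (simp add: complex_dim_def max_face_card_def)

lemma face_count_pos_iff:
  assumes "finite \<Delta>"
  shows "0 < face_count \<Delta> k \<longleftrightarrow> k \<in> card ` \<Delta>"
  using assms by (auto simp: face_count_def card_gt_0_iff)

lemma face_count_eq_0:
  assumes "finite \<Delta>" "max_face_card \<Delta> < k"
  shows "face_count \<Delta> k = 0"
proof -
  have "k \<notin> card ` \<Delta>"
    using Max_ge[of "card ` \<Delta>" k] assms unfolding max_face_card_def by (meson finite_imageI leD)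
  then show ?thesis using face_count_pos_iff[OF assms(1)] by blast
qed

text \<open>
  The polynomial \<open>(1 - t)^d F(t / (1 - t))\<close>, where \<open>F\<close> is the generating function of the face counts
  \<open>\<phi>\<close>. The exponent \<open>d\<close> is a separate argument, since the h-polynomials of complexes of different
  dimension are to be compared at a common \<open>d\<close>.
\<close>

definition h_poly :: "nat \<Rightarrow> (nat \<Rightarrow> int) \<Rightarrow> int poly" where
  "h_poly d \<phi> = (\<Sum>k\<le>d. smult (\<phi> k) (monom 1 k * [:1, -1:] ^ (d - k)))"

lemma coeff_one_minus_X_power:
  "coeff ([:1, -1:] ^ m) j = (-1) ^ j * (of_nat (m choose j) :: int)"
proof (induction m arbitrary: j)
  case 0
  then show ?case by (simp add: coeff_1)
next
  case (Suc m)
  have "[:1, -1:] ^ Suc m = [:1, -1:] ^ m - pCons 0 ([:1, -1 :: int:] ^ m)" by simp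
  then have "coeff ([:1, -1 :: int:] ^ Suc m) j =
      coeff ([:1, -1:] ^ m) j - coeff (pCons 0 ([:1, -1:] ^ m)) j"
    by (simp only: coeff_diff)
  then show ?case using Suc by (cases j) (simp_all add: algebra_simps del: power_Suc, simp)
qed

lemma coeff_h_poly:
  "coeff (h_poly d \<phi>) j = (if d < j then 0 else
     (\<Sum>i=0..j. (-1) ^ (j - i) * int ((d - i) choose (j - i)) * \<phi> i))"
proof -
  have coeff_term: "coeff (smult (\<phi> k) (monom 1 k * [:1, -1:] ^ (d - k))) j =
      (if k \<le> j then (-1) ^ (j - k) * int ((d - k) choose (j - k)) * \<phi> k else 0)" for k
    by (simp add: coeff_monom_mult coeff_one_minus_X_power)
  have "coeff (h_poly d \<phi>) j =
    (\<Sum>k\<le>d. if k \<le> j then (-1) ^ (j - k) * int ((d - k) choose (j - k)) * \<phi> k else 0)"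
    by (simp add: h_poly_def coeff_sum coeff_term del: coeff_smult)
  also have "\<dots> = (\<Sum>k\<in>{..d} \<inter> {k. k \<le> j}. (-1) ^ (j - k) * int ((d - k) choose (j - k)) * \<phi> k)"
    by (simp add: sum.inter_restrict)
  also have "\<dots> = (if d < j then 0 else
     (\<Sum>i=0..j. (-1) ^ (j - i) * int ((d - i) choose (j - i)) * \<phi> i))"
  proof (cases "d < j")
    case True
    then show ?thesis by (auto intro!: sum.neutral)
  next
    case False
    then have "{..d} \<inter> {k. k \<le> j} = {0..j}" by auto
    then show ?thesis using False by simp
  qed
  finally show ?thesis .
qed

lemma h_number_eq_coeff:
  "h_number \<Delta> (int j) = coeff (h_poly (max_face_card \<Delta>) (\<lambda>k. int (face_count \<Delta> k))) j"
  by (simp add: h_number_def complex_dim_eq coeff_h_poly f_number_eq_face_count Let_def)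

lemma h_number_pred_eq_coeff:
  "h_number \<Delta> (int j - 1) = coeff (pCons 0 (h_poly (max_face_card \<Delta>) (\<lambda>k. int (face_count \<Delta> k)))) j"
proof (cases j)
  case 0
  then show ?thesis by (simp add: h_number_def)
next
  case (Suc j')
  then show ?thesis using h_number_eq_coeff[of \<Delta> j'] by simp
qed

lemma h_poly_add: "h_poly d (\<lambda>k. \<phi> k + \<phi>' k) = h_poly d \<phi> + h_poly d \<phi>'"
  by (simp add: h_poly_def smult_add_left sum.distrib)

text \<open>
  The price of raising the exponent by one is a factor \<open>1 - t\<close>; this factor is the source of the extra
  term in the h-vector recurrence at indices where the dimension jumps.
\<close>

lemma h_poly_Suc:
  assumes "\<phi> (Suc d) = 0"
  shows "h_poly (Suc d) \<phi> = [:1, -1:] * h_poly d \<phi>"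
proof -
  have "h_poly (Suc d) \<phi> = (\<Sum>k\<le>d. smult (\<phi> k) (monom 1 k * [:1, -1:] ^ (Suc d - k)))"
    using assms by (simp add: h_poly_def)
  also have "\<dots> = (\<Sum>k\<le>d. [:1, -1:] * smult (\<phi> k) (monom 1 k * [:1, -1:] ^ (d - k)))"
    by (intro sum.cong refl) (simp add: Suc_diff_le mult_smult_right mult.left_commute del: mult_pCons_left)
  finally show ?thesis by (simp only: h_poly_def sum_distrib_left)
qed

text \<open>
  Multiplying \<open>F\<close> by \<open>t\<close> while raising the exponent by one multiplies the h-polynomial by \<open>t\<close>, because
  \<open>(1 - t) (t / (1 - t)) = t\<close>.
\<close>

lemma h_poly_shift:
  "h_poly (Suc d) (\<lambda>k. case k of 0 \<Rightarrow> 0 | Suc k' \<Rightarrow> \<phi> k') = pCons 0 (h_poly d \<phi>)"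
proof -
  have "h_poly (Suc d) (\<lambda>k. case k of 0 \<Rightarrow> 0 | Suc k' \<Rightarrow> \<phi> k') =
    (\<Sum>k\<le>d. smult (\<phi> k) (monom 1 (Suc k) * [:1, -1:] ^ (d - k)))"
    unfolding h_poly_def by (subst sum.atMost_Suc_shift) simp
  also have "\<dots> = (\<Sum>k\<le>d. monom 1 1 * smult (\<phi> k) (monom 1 k * [:1, -1:] ^ (d - k)))"
    by (intro sum.cong refl) (simp add: mult_smult_right mult_monom flip: mult.assoc)
  also have "\<dots> = monom 1 1 * h_poly d \<phi>" by (simp add: h_poly_def sum_distrib_left)
  finally show ?thesis by (simp add: monom_altdef)
qed

text \<open>
  The reduced Euler characteristic is \<open>- F(-1)\<close>. The summation bound \<open>d\<close> is arbitrary so that several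
  complexes can share it.
\<close>

lemma reduced_euler_char_eq:
  assumes "finite \<Delta>" "{} \<in> \<Delta>" "\<And>F. F \<in> \<Delta> \<Longrightarrow> finite F" "max_face_card \<Delta> \<le> d"
  shows "reduced_euler_char \<Delta> = - (\<Sum>k\<le>d. (-1) ^ k * int (face_count \<Delta> k))"
proof -
  have "{F \<in> \<Delta>. card F = 0} = {{}}" using assms(2,3) by auto
  then have 0: "face_count \<Delta> 0 = 1" by (simp add: face_count_def)
  have "(\<Sum>k\<le>d. (-1) ^ k * int (face_count \<Delta> k)) =
    (\<Sum>k\<le>max_face_card \<Delta>. (-1) ^ k * int (face_count \<Delta> k))"
    using assms(4) face_count_eq_0[OF assms(1)] by (intro sum.mono_neutral_right) auto
  also have "\<dots> = 1 - (\<Sum>k<max_face_card \<Delta>. (-1) ^ k * int (face_count \<Delta> (Suc k)))"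
    by (simp add: sum.atMost_shift 0 sum_negf)
  also have "(\<Sum>k<max_face_card \<Delta>. (-1) ^ k * int (face_count \<Delta> (Suc k))) = euler_char \<Delta>"
    using f_number_eq_face_count[of \<Delta> "Suc _"] by (simp add: euler_char_def complex_dim_eq)
  finally show ?thesis by (simp add: reduced_euler_char_def)
qed

text \<open>
  Three complexes whose face polynomials satisfy \<open>F = F1 + t Fs\<close>. All face invariants of \<open>\<Delta>\<close> are
  determined by \<open>F\<close>, so each of them inherits a recurrence.
\<close>

locale face_recurrence =
  fixes \<Delta> \<Delta>1 \<Delta>s :: "'a set set"
  assumes fin: "finite \<Delta>" "finite \<Delta>1" "finite \<Delta>s"
    and empty_face: "{} \<in> \<Delta>" "{} \<in> \<Delta>1" "{} \<in> \<Delta>s"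
    and fin_face: "F \<in> \<Delta> \<union> \<Delta>1 \<union> \<Delta>s \<Longrightarrow> finite F"
    and face_count_Suc: "face_count \<Delta> (Suc k) = face_count \<Delta>1 (Suc k) + face_count \<Delta>s k"
begin

lemma face_count_0: "face_count \<Delta> 0 = 1" "face_count \<Delta>1 0 = 1"
proof -
  have "{F \<in> \<Delta>. card F = 0} = {{}}" "{F \<in> \<Delta>1. card F = 0} = {{}}" using empty_face fin_face by auto
  then show "face_count \<Delta> 0 = 1" "face_count \<Delta>1 0 = 1" by (simp_all add: face_count_def)
qed

lemma face_count_eq:
  "int (face_count \<Delta> k) = int (face_count \<Delta>1 k) + (case k of 0 \<Rightarrow> 0 | Suc k' \<Rightarrow> int (face_count \<Delta>s k'))"
  using face_count_0 by (simp add: face_count_Suc split: nat.split)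

lemma f_number_eq:
  assumes "0 \<le> i"
  shows "f_number \<Delta> i = f_number \<Delta>1 i + f_number \<Delta>s (i - 1)"
proof -
  obtain k where "i = int (Suc k) - 1" using assms by (metis add_diff_cancel_right' nonneg_int_cases of_nat_Suc add.commute)
  then show ?thesis
    using f_number_eq_face_count[of \<Delta> "Suc k"] f_number_eq_face_count[of \<Delta>1 "Suc k"]
      f_number_eq_face_count[of \<Delta>s k] face_count_Suc[of k] by simp
qed

text \<open>
  No cancellation occurs in a sum of natural numbers, so the degree of \<open>F1 + t Fs\<close> is the maximum of
  the two degrees.
\<close>

lemma max_face_card_eq: "max_face_card \<Delta> = max (max_face_card \<Delta>1) (max_face_card \<Delta>s + 1)"
proof -
  have "card ` \<Delta> = card ` \<Delta>1 \<union> Suc ` card ` \<Delta>s"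
  proof (rule set_eqI)
    fix k
    show "k \<in> card ` \<Delta> \<longleftrightarrow> k \<in> card ` \<Delta>1 \<union> Suc ` card ` \<Delta>s"
    proof (cases k)
      case 0
      then show ?thesis using face_count_0 face_count_pos_iff[of \<Delta> 0] face_count_pos_iff[of \<Delta>1 0] fin by simp
    next
      case (Suc k')
      have "k \<in> card ` \<Delta> \<longleftrightarrow> 0 < face_count \<Delta>1 k \<or> 0 < face_count \<Delta>s k'"
        unfolding face_count_pos_iff[OF fin(1), symmetric] Suc face_count_Suc by simp
      also have "\<dots> \<longleftrightarrow> k \<in> card ` \<Delta>1 \<or> k' \<in> card ` \<Delta>s"
        using face_count_pos_iff[OF fin(2)] face_count_pos_iff[OF fin(3)] by simp
      finally show ?thesis by (simp add: Suc inj_image_mem_iff)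
    qed
  qed
  moreover have "Max (Suc ` card ` \<Delta>s) = Suc (Max (card ` \<Delta>s))"
    using fin empty_face by (subst mono_Max_commute[of Suc]) (auto simp: mono_def)
  ultimately show ?thesis
    using fin empty_face by (simp add: max_face_card_def) (subst Max_Un, auto)
qed

lemma h_poly_eq:
  "h_poly (Suc d) (\<lambda>k. int (face_count \<Delta> k)) =
   h_poly (Suc d) (\<lambda>k. int (face_count \<Delta>1 k)) + pCons 0 (h_poly d (\<lambda>k. int (face_count \<Delta>s k)))"
  unfolding face_count_eq h_poly_add h_poly_shift ..

lemma h_number_same_dim:
  assumes "0 \<le> i" "max_face_card \<Delta>1 = max_face_card \<Delta>" "max_face_card \<Delta> = max_face_card \<Delta>s + 1"
  shows "h_number \<Delta> i = h_number \<Delta>1 i + h_number \<Delta>s (i - 1)"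
proof -
  obtain j where "i = int j" using assms(1) nonneg_int_cases by blast
  then show ?thesis
    using h_poly_eq[of "max_face_card \<Delta>s"] assms
    by (simp add: h_number_eq_coeff h_number_pred_eq_coeff del: coeff_pCons_0)
qed

lemma h_number_dim_jump:
  assumes "0 \<le> i" "max_face_card \<Delta> = max_face_card \<Delta>1 + 1" "max_face_card \<Delta> = max_face_card \<Delta>s + 1"
  shows "h_number \<Delta> i = h_number \<Delta>1 i - h_number \<Delta>1 (i - 1) + h_number \<Delta>s (i - 1)"
proof -
  obtain j where i: "i = int j" using assms(1) nonneg_int_cases by blast
  let ?h1 = "h_poly (max_face_card \<Delta>1) (\<lambda>k. int (face_count \<Delta>1 k))"
  have "h_poly (Suc (max_face_card \<Delta>1)) (\<lambda>k. int (face_count \<Delta>1 k)) = [:1, -1:] * ?h1"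
    using face_count_eq_0[OF fin(2)] by (intro h_poly_Suc) simp
  also have "\<dots> = ?h1 - pCons 0 ?h1" by simp
  finally show ?thesis
    using h_poly_eq[of "max_face_card \<Delta>s"] assms
    by (simp add: i h_number_eq_coeff h_number_pred_eq_coeff)
qed

lemma reduced_euler_char_eq_diff:
  "reduced_euler_char \<Delta> = reduced_euler_char \<Delta>1 - reduced_euler_char \<Delta>s"
proof -
  define d where "d = max_face_card \<Delta>"
  have d: "max_face_card \<Delta> \<le> Suc d" "max_face_card \<Delta>1 \<le> Suc d" "max_face_card \<Delta>s \<le> d"
    using max_face_card_eq by (auto simp: d_def)
  have "(\<Sum>k\<le>Suc d. (-1) ^ k * int (face_count \<Delta> k)) =
      (\<Sum>k\<le>Suc d. (-1) ^ k * int (face_count \<Delta>1 k)) +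
      (\<Sum>k\<le>Suc d. (-1) ^ k * (case k of 0 \<Rightarrow> 0 | Suc k' \<Rightarrow> int (face_count \<Delta>s k')))"
    unfolding face_count_eq distrib_left sum.distrib ..
  also have "(\<Sum>k\<le>Suc d. (-1) ^ k * (case k of 0 \<Rightarrow> 0 | Suc k' \<Rightarrow> int (face_count \<Delta>s k'))) =
      - (\<Sum>k\<le>d. (-1) ^ k * int (face_count \<Delta>s k))"
    by (subst sum.atMost_Suc_shift) (simp add: sum_negf)
  finally show ?thesis
    using reduced_euler_char_eq[OF fin(1) empty_face(1) _ d(1)]
      reduced_euler_char_eq[OF fin(2) empty_face(2) _ d(2)]
      reduced_euler_char_eq[OF fin(3) empty_face(3) _ d(3)] fin_face by simp
qed

end

section \<open>Counting cliques by their trace on the last vertices\<close>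

text \<open>
  \<open>T\<close> stands for the edges \<open>(a, b)\<close>, \<open>a < b\<close>, of the graph at the stability index \<open>r\<close>, and \<open>s\<close> for the
  sparsity index. The graph at any index \<open>n \<ge> r\<close> can be read off from \<open>T\<close>: its edges are the pairs whose
  triple of distances dominates that of some member of \<open>T\<close>.
\<close>

locale edge_profile =
  fixes T :: "(nat \<times> nat) set" and r s :: nat
  assumes bounds: "(a, b) \<in> T \<Longrightarrow> 1 \<le> a \<and> a + s \<le> b \<and> b \<le> r"
    and s_pos: "1 \<le> s"
    and gap_attained: "\<exists>p. (p, p + s) \<in> T"
    and touches_first: "\<exists>b. (1, b) \<in> T"
    and touches_last: "\<exists>a. (a, r) \<in> T"
begin

definition adj :: "nat \<Rightarrow> nat \<Rightarrow> nat \<Rightarrow> bool" where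
  "adj n i j \<longleftrightarrow> (\<exists>(a, b)\<in>T. a \<le> i \<and> i + b \<le> j + a \<and> j + r \<le> n + b)"

text \<open>
  The limits of adjacency for two vertices far from \<open>n\<close>, for two vertices \<open>n - b1\<close> and \<open>n - b2\<close> close to
  \<open>n\<close>, and for a vertex \<open>x\<close> close to \<open>0\<close> against a vertex \<open>n - \<beta>\<close> close to \<open>n\<close>. Each
  drops the inequality that holds automatically in its situation, and none of them depends on \<open>n\<close>.
\<close>

definition adj_inf :: "nat \<Rightarrow> nat \<Rightarrow> bool" where
  "adj_inf i j \<longleftrightarrow> (\<exists>(a, b)\<in>T. a \<le> i \<and> i + b \<le> j + a)"

definition adj_end :: "nat \<Rightarrow> nat \<Rightarrow> bool" where
  "adj_end b2 b1 \<longleftrightarrow> (\<exists>(a, b)\<in>T. b2 + b \<le> b1 + a \<and> r \<le> b2 + b)"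

definition adj_across :: "nat \<Rightarrow> nat \<Rightarrow> bool" where
  "adj_across x \<beta> \<longleftrightarrow> (\<exists>(a, b)\<in>T. a \<le> x \<and> r \<le> \<beta> + b)"

text \<open>
  The least distance at which a vertex in the middle is adjacent to \<open>n - \<beta>\<close>.
\<close>

definition end_gap :: "nat \<Rightarrow> nat" where
  "end_gap \<beta> = (LEAST g. \<exists>(a, b)\<in>T. r \<le> \<beta> + b \<and> b = a + g)"

definition cliques :: "nat \<Rightarrow> nat set set" where
  "cliques n = {C. C \<subseteq> {1..n} \<and> (\<forall>i\<in>C. \<forall>j\<in>C. i < j \<longrightarrow> adj n i j)}"

lemma adj_gap: "adj n i j \<Longrightarrow> i + s \<le> j"
  unfolding adj_def using bounds by fastforce

lemma adj_start_start: "j + r \<le> n \<Longrightarrow> adj n i j \<longleftrightarrow> adj_inf i j"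
  unfolding adj_def adj_inf_def by fastforce

lemma adj_end_end:
  assumes "b1 < r" "b2 < r" "2 * r \<le> n"
  shows "adj n (n - b1) (n - b2) \<longleftrightarrow> adj_end b2 b1"
  unfolding adj_def adj_end_def
proof (rule bex_cong[OF refl], clarify)
  fix a b assume "(a, b) \<in> T"
  then show "a \<le> n - b1 \<and> n - b1 + b \<le> n - b2 + a \<and> n - b2 + r \<le> n + b \<longleftrightarrow> b2 + b \<le> b1 + a \<and> r \<le> b2 + b"
    using bounds[of a b] assms by auto
qed

lemma end_gap:
  shows "\<exists>a. (a, a + end_gap \<beta>) \<in> T \<and> r \<le> \<beta> + (a + end_gap \<beta>)"
    and "(a, b) \<in> T \<Longrightarrow> r \<le> \<beta> + b \<Longrightarrow> a + end_gap \<beta> \<le> b"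
proof -
  let ?P = "\<lambda>g. \<exists>(a, b)\<in>T. r \<le> \<beta> + b \<and> b = a + g"
  obtain a0 where a0: "(a0, r) \<in> T" using touches_last by blast
  have "?P (r - a0)" using a0 bounds[OF a0] by (intro bexI[of _ "(a0, r)"]) auto
  from LeastI[of ?P, OF this] show "\<exists>a. (a, a + end_gap \<beta>) \<in> T \<and> r \<le> \<beta> + (a + end_gap \<beta>)"
    unfolding end_gap_def by blast
  show "a + end_gap \<beta> \<le> b" if "(a, b) \<in> T" "r \<le> \<beta> + b"
  proof -
    have "?P (b - a)" using that bounds[of a b] by (intro bexI[of _ "(a, b)"]) auto
    then have "end_gap \<beta> \<le> b - a" unfolding end_gap_def by (rule Least_le)
    then show ?thesis using bounds[of a b] that by auto
  qed
qed

lemma end_gap_le: "end_gap \<beta> \<le> r"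
  using end_gap(1)[of \<beta>] bounds by fastforce

text \<open>
  For \<open>x \<ge> r\<close> the constraint on the left coordinate is void, so only the gap matters and the smallest
  available gap is decisive. For \<open>x < r\<close> the vertices are at distance at least \<open>r\<close>, so the gap constraint is void
  instead.
\<close>

lemma adj_start_end:
  assumes "\<beta> < r" "3 * r \<le> n" "x + r \<le> n"
  shows "adj n x (n - \<beta>) \<longleftrightarrow> x + (\<beta> + end_gap \<beta>) \<le> n \<and> (x < r \<longrightarrow> adj_across x \<beta>)"
    (is "_ \<longleftrightarrow> ?R")
proof
  assume "adj n x (n - \<beta>)"
  then obtain a b where ab: "(a, b) \<in> T" "a \<le> x" "x + b \<le> n - \<beta> + a" "n - \<beta> + r \<le> n + b"
    unfolding adj_def by blast
  have "a + end_gap \<beta> \<le> b" using end_gap(2)[of a b \<beta>] ab assms by auto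
  then show ?R using ab assms unfolding adj_across_def by force
next
  assume R: ?R
  show "adj n x (n - \<beta>)"
  proof (cases "x < r")
    case True
    then obtain a b where "(a, b) \<in> T" "a \<le> x" "r \<le> \<beta> + b" using R unfolding adj_across_def by blast
    then show ?thesis unfolding adj_def
      using bounds[of a b] True assms by (intro bexI[of _ "(a, b)"]) auto
  next
    case False
    obtain a where a: "(a, a + end_gap \<beta>) \<in> T" "r \<le> \<beta> + (a + end_gap \<beta>)" using end_gap(1) by blast
    show ?thesis unfolding adj_def
      using bounds[OF a(1)] False assms a R by (intro bexI[of _ "(a, a + end_gap \<beta>)"]) auto
  qed
qed

text \<open>
  A vertex \<open>x < r\<close> is joined to \<open>y\<close> through the edge of \<open>T\<close> at \<open>1\<close>, since \<open>y\<close> is at distance more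
  than \<open>r\<close>; a vertex \<open>x \<ge> r\<close> is joined to \<open>y\<close> through an edge of \<open>T\<close> of minimal length \<open>s\<close>.
\<close>

lemma adj_inf_iff_gap:
  assumes "2 * r \<le> y"
  shows "adj_inf x y \<longleftrightarrow> 1 \<le> x \<and> x + s \<le> y"
proof
  assume "adj_inf x y"
  then show "1 \<le> x \<and> x + s \<le> y" unfolding adj_inf_def using bounds by fastforce
next
  assume x: "1 \<le> x \<and> x + s \<le> y"
  show "adj_inf x y"
  proof (cases "x < r")
    case True
    obtain b where b: "(1, b) \<in> T" using touches_first by blast
    then show ?thesis unfolding adj_inf_def
      using bounds[OF b] True x assms by (intro bexI[of _ "(1, b)"]) auto
  next
    case False
    obtain p where p: "(p, p + s) \<in> T" using gap_attained by blast
    then show ?thesis unfolding adj_inf_def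
      using bounds[OF p] False x assms by (intro bexI[of _ "(p, p + s)"]) auto
  qed
qed

text \<open>
  The sets \<open>D\<close> of \<open>k\<close> vertices in \<open>{1..y}\<close> that can precede the reversed end part \<open>B\<close>. All
  dependence on \<open>n\<close> is through \<open>y\<close>.
\<close>

definition start_parts :: "nat set \<Rightarrow> nat \<Rightarrow> nat \<Rightarrow> nat set set" where
  "start_parts B y k = {D. D \<subseteq> {1..y} \<and> card D = k \<and> (\<forall>i\<in>D. \<forall>j\<in>D. i < j \<longrightarrow> adj_inf i j)
     \<and> (\<forall>i\<in>D. i < r \<longrightarrow> (\<forall>\<beta>\<in>B. adj_across i \<beta>))}"

lemma finite_start_parts: "finite (start_parts B y k)"
  by (rule finite_subset[of _ "Pow {1..y}"]) (auto simp: start_parts_def)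

lemma start_parts_0: "start_parts B y 0 = {{}}"
proof -
  have "D = {}" if "D \<subseteq> {1..y}" "card D = 0" for D
    using that finite_subset[of D "{1..y}"] by auto
  then show ?thesis by (auto simp: start_parts_def)
qed

text \<open>
  For large \<open>y\<close> the neighbours of \<open>y\<close> below it are the vertices of \<open>{1..y - s}\<close>, and \<open>y \<ge> r\<close> is
  compatible with \<open>B\<close> without further condition.
\<close>

lemma start_parts_with_top:
  assumes y: "2 * r + s \<le> y"
  shows "{D \<in> start_parts B y (Suc k). y \<in> D} = insert y ` start_parts B (y - s) k" (is "?L = ?R")
proof
  show "?L \<subseteq> ?R"
  proof
    fix D assume "D \<in> ?L"
    then have D: "D \<subseteq> {1..y}" "card D = Suc k" "y \<in> D"
      "\<And>i j. i \<in> D \<Longrightarrow> j \<in> D \<Longrightarrow> i < j \<Longrightarrow> adj_inf i j"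
      "\<And>i \<beta>. i \<in> D \<Longrightarrow> i < r \<Longrightarrow> \<beta> \<in> B \<Longrightarrow> adj_across i \<beta>"
      by (auto simp: start_parts_def)
    have "D - {y} \<subseteq> {1..y - s}"
    proof
      fix x assume x: "x \<in> D - {y}"
      then have "x < y" using D(1) by force
      then have "adj_inf x y" using D(3,4) x by blast
      then show "x \<in> {1..y - s}" using adj_inf_iff_gap[of y x] y by auto
    qed
    moreover have "card (D - {y}) = k"
      using D(1-3) finite_subset[of D "{1..y}"] by (simp add: card_Diff_singleton)
    ultimately have "D - {y} \<in> start_parts B (y - s) k" using D(4,5) by (auto simp: start_parts_def)
    moreover have "D = insert y (D - {y})" using D(3) by blast
    ultimately show "D \<in> ?R" by blast
  qed
  show "?R \<subseteq> ?L"
  proof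
    fix D' assume "D' \<in> ?R"
    then obtain D where D': "D' = insert y D" and D: "D \<subseteq> {1..y - s}" "card D = k"
      "\<And>i j. i \<in> D \<Longrightarrow> j \<in> D \<Longrightarrow> i < j \<Longrightarrow> adj_inf i j"
      "\<And>i \<beta>. i \<in> D \<Longrightarrow> i < r \<Longrightarrow> \<beta> \<in> B \<Longrightarrow> adj_across i \<beta>"
      by (auto simp: start_parts_def)
    have D_lt: "1 \<le> i \<and> i + s \<le> y" if "i \<in> D" for i using that D(1) s_pos y by force
    have "y \<notin> D" using D_lt s_pos by force
    then have "card D' = Suc k" using D(1,2) finite_subset[of D "{1..y-s}"] by (simp add: D')
    moreover have "adj_inf i j" if "i \<in> D'" "j \<in> D'" "i < j" for i j
      using that D(3) D_lt[of i] D_lt[of j] adj_inf_iff_gap[of y i] y by (auto simp: D')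
    moreover have "D' \<subseteq> {1..y}" using D_lt y s_pos by (force simp: D')
    moreover have "adj_across i \<beta>" if "i \<in> D'" "i < r" "\<beta> \<in> B" for i \<beta>
      using that D(4) y by (auto simp: D')
    ultimately show "D' \<in> ?L" by (auto simp: start_parts_def D')
  qed
qed

lemma card_start_parts_Suc:
  assumes y: "2 * r + s \<le> y"
  shows "card (start_parts B y (Suc k)) =
    card (start_parts B (y - 1) (Suc k)) + card (start_parts B (y - s) k)"
proof -
  have "{D \<in> start_parts B y (Suc k). y \<notin> D} = start_parts B (y - 1) (Suc k)"
  proof -
    have "D \<subseteq> {1..y} \<and> y \<notin> D \<longleftrightarrow> D \<subseteq> {1..y - 1}" for D
      using y s_pos by (force simp: subset_iff le_less)
    then show ?thesis by (auto simp: start_parts_def)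
  qed
  moreover have "card (insert y ` start_parts B (y - s) k) = card (start_parts B (y - s) k)"
  proof (rule card_image)
    have "y \<notin> D" if "D \<in> start_parts B (y - s) k" for D
      using that y s_pos by (force simp: start_parts_def)
    then show "inj_on (insert y) (start_parts B (y - s) k)"
      by (auto simp: inj_on_def dest: insert_ident)
  qed
  moreover have "card (start_parts B y (Suc k)) =
      card {D \<in> start_parts B y (Suc k). y \<notin> D} + card {D \<in> start_parts B y (Suc k). y \<in> D}"
    by (subst card_Un_disjoint[symmetric])
      (auto intro: finite_subset[OF _ finite_start_parts] arg_cong[where f = card])
  ultimately show ?thesis using start_parts_with_top[OF y] by simp
qed

text \<open>
  The vertices at distance at least \<open>margin B\<close> from \<open>n\<close> are those that lie outside the last \<open>r\<close>
  positions and far enough from every vertex of the end part.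
\<close>

definition margin :: "nat set \<Rightarrow> nat" where
  "margin B = Max (insert r ((\<lambda>\<beta>. \<beta> + end_gap \<beta>) ` B))"

lemma margin_le_iff:
  "finite B \<Longrightarrow> margin B \<le> m \<longleftrightarrow> r \<le> m \<and> (\<forall>\<beta>\<in>B. \<beta> + end_gap \<beta> \<le> m)"
  by (auto simp: margin_def)

lemma margin_le: "B \<subseteq> {..<r} \<Longrightarrow> margin B \<le> 2 * r"
  using end_gap_le finite_subset[of B "{..<r}"]
  by (subst margin_le_iff) (auto simp: add_mono mult_2 subset_iff less_imp_le)

definition end_part_clique :: "nat set \<Rightarrow> bool" where
  "end_part_clique B \<longleftrightarrow> (\<forall>b1\<in>B. \<forall>b2\<in>B. b2 < b1 \<longrightarrow> adj_end b2 b1)"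

text \<open>
  A clique splits into the part \<open>D\<close> in \<open>{1..n - r}\<close> and the end part, encoded by the distances \<open>B\<close> to
  \<open>n\<close>. Each of the three kinds of adjacency has a form that does not see \<open>n\<close>, except that \<open>D\<close> has to
  keep the distance \<open>margin B\<close> from \<open>n\<close>.
\<close>

lemma clique_split_iff:
  assumes B: "B \<subseteq> {..<r}" and n: "3 * r \<le> n" and D: "D \<subseteq> {1..n - r}"
  shows "D \<union> (\<lambda>\<beta>. n - \<beta>) ` B \<in> cliques n \<longleftrightarrow>
    end_part_clique B \<and> D \<in> start_parts B (n - margin B) (card D)"
proof -
  have finB: "finite B" using B finite_subset by blast
  have Dn: "1 \<le> x \<and> x + r \<le> n" if "x \<in> D" for x using that D n by force
  have Bn: "\<beta> < r" if "\<beta> \<in> B" for \<beta> using that B by blast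
  have lt: "x < n - \<beta>" if "x \<in> D" "\<beta> \<in> B" for x \<beta> using Dn[OF that(1)] Bn[OF that(2)] by linarith
  have "D \<union> (\<lambda>\<beta>. n - \<beta>) ` B \<subseteq> {1..n}" using Dn Bn n by force
  then have "D \<union> (\<lambda>\<beta>. n - \<beta>) ` B \<in> cliques n \<longleftrightarrow>
    (\<forall>i\<in>D. \<forall>j\<in>D. i < j \<longrightarrow> adj n i j) \<and>
    (\<forall>b1\<in>B. \<forall>b2\<in>B. n - b1 < n - b2 \<longrightarrow> adj n (n - b1) (n - b2)) \<and>
    (\<forall>i\<in>D. \<forall>\<beta>\<in>B. adj n i (n - \<beta>))"
    using lt by (auto simp: cliques_def ball_Un dest: less_asym)
  also have "(\<forall>i\<in>D. \<forall>j\<in>D. i < j \<longrightarrow> adj n i j) \<longleftrightarrow> (\<forall>i\<in>D. \<forall>j\<in>D. i < j \<longrightarrow> adj_inf i j)"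
    using adj_start_start Dn by (intro ball_cong refl imp_cong) auto
  also have "(\<forall>b1\<in>B. \<forall>b2\<in>B. n - b1 < n - b2 \<longrightarrow> adj n (n - b1) (n - b2)) \<longleftrightarrow> end_part_clique B"
    unfolding end_part_clique_def
  proof (intro ball_cong refl imp_cong)
    fix b1 b2 assume "b1 \<in> B" "b2 \<in> B"
    then have b: "b1 < r" "b2 < r" using Bn by auto
    show "(n - b1 < n - b2) = (b2 < b1)" using b n by auto
    show "adj n (n - b1) (n - b2) = adj_end b2 b1" using b n by (intro adj_end_end) auto
  qed
  also have "(\<forall>i\<in>D. \<forall>\<beta>\<in>B. adj n i (n - \<beta>)) \<longleftrightarrow>
      (\<forall>i\<in>D. \<forall>\<beta>\<in>B. i + (\<beta> + end_gap \<beta>) \<le> n \<and> (i < r \<longrightarrow> adj_across i \<beta>))"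
    using adj_start_end Dn Bn n by (intro ball_cong refl) auto
  also have "\<dots> \<longleftrightarrow> D \<subseteq> {1..n - margin B} \<and> (\<forall>i\<in>D. i < r \<longrightarrow> (\<forall>\<beta>\<in>B. adj_across i \<beta>))"
  proof -
    have "i \<in> {1..n - margin B} \<longleftrightarrow> (\<forall>\<beta>\<in>B. i + (\<beta> + end_gap \<beta>) \<le> n)" if "i \<in> D" for i
    proof -
      have "i \<in> {1..n - margin B} \<longleftrightarrow> margin B \<le> n - i" using Dn[OF that] by auto
      also have "\<dots> \<longleftrightarrow> (\<forall>\<beta>\<in>B. i + (\<beta> + end_gap \<beta>) \<le> n)"
        unfolding margin_le_iff[OF finB] using Dn[OF that] by (auto simp: le_diff_conv2 add.commute)
      finally show ?thesis .
    qed
    then show ?thesis by blast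
  qed
  finally show ?thesis by (auto simp: start_parts_def)
qed

lemma clique_count_eq_sum:
  assumes n: "3 * r \<le> n"
  shows "face_count (cliques n) k =
    (\<Sum>B\<in>{B \<in> Pow {..<r}. end_part_clique B \<and> card B \<le> k}. card (start_parts B (n - margin B) (k - card B)))"
    (is "_ = (\<Sum>B\<in>?I. card (?S B))")
proof -
  let ?C = "{C \<in> cliques n. card C = k}"
  let ?E = "\<lambda>B. (\<lambda>\<beta>. n - \<beta>) ` B"
  have S_sub: "D \<subseteq> {1..n - r}" if "B \<in> ?I" "D \<in> ?S B" for B D
  proof -
    have "r \<le> margin B" using that(1) margin_le_iff[of B "margin B"] finite_subset[of B "{..<r}"] by auto
    then show ?thesis using that(2) by (force simp: start_parts_def)
  qed
  \<comment> \<open>The two parts occupy disjoint intervals, so a clique determines both of them.\<close>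
  have recover: "D = (D \<union> ?E B) \<inter> {1..n - r}" "B = {\<beta>. \<beta> < r \<and> n - \<beta> \<in> D \<union> ?E B}"
    if "B \<subseteq> {..<r}" "D \<subseteq> {1..n - r}" for B D
  proof -
    have B: "\<beta> < r" if "\<beta> \<in> B" for \<beta> using that \<open>B \<subseteq> _\<close> by blast
    have D: "1 \<le> x \<and> x + r \<le> n" if "x \<in> D" for x using that \<open>D \<subseteq> _\<close> n by force
    show "D = (D \<union> ?E B) \<inter> {1..n - r}" using B that(2) n by (auto dest!: B)
    show "B = {\<beta>. \<beta> < r \<and> n - \<beta> \<in> D \<union> ?E B}"
    proof (intro equalityI subsetI CollectI conjI)
      fix \<beta> assume "\<beta> \<in> {\<beta>. \<beta> < r \<and> n - \<beta> \<in> D \<union> ?E B}"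
      then have \<beta>: "\<beta> < r" "n - \<beta> \<in> D \<or> (\<exists>\<beta>'\<in>B. n - \<beta> = n - \<beta>')" by auto
      have "n - \<beta> \<notin> D" using D[of "n - \<beta>"] \<beta>(1) n by linarith
      then obtain \<beta>' where "\<beta>' \<in> B" "n - \<beta> = n - \<beta>'" using \<beta>(2) by blast
      moreover have "\<beta>' < r" using calculation B by blast
      ultimately have "\<beta> = \<beta>'" using \<beta>(1) n by linarith
      then show "\<beta> \<in> B" using \<open>\<beta>' \<in> B\<close> by simp
    qed (use B in auto)
  qed
  have card_glue: "card (D \<union> ?E B) = card D + card B" if "B \<subseteq> {..<r}" "D \<subseteq> {1..n - r}" for B D
  proof -
    have fin: "finite D" "finite B" using that finite_subset by auto
    have "inj_on (\<lambda>\<beta>. n - \<beta>) B" using that(1) n by (auto simp: inj_on_def subset_iff)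
    moreover have "D \<inter> ?E B = {}" using that n by (force simp: subset_iff)
    ultimately show ?thesis using fin by (simp add: card_Un_disjoint card_image)
  qed
  have "bij_betw (\<lambda>(B, D). D \<union> ?E B) (SIGMA B:?I. ?S B) ?C"
    unfolding bij_betw_def
  proof
    show "inj_on (\<lambda>(B, D). D \<union> ?E B) (SIGMA B:?I. ?S B)"
    proof (rule inj_onI, clarify)
      fix B D B' D'
      assume *: "B \<subseteq> {..<r}" "end_part_clique B" "card B \<le> k" "D \<in> ?S B"
        "B' \<subseteq> {..<r}" "end_part_clique B'" "card B' \<le> k" "D' \<in> ?S B'"
        and eq: "D \<union> ?E B = D' \<union> ?E B'"
      have "D \<subseteq> {1..n - r}" "D' \<subseteq> {1..n - r}" using S_sub * by auto
      then show "B = B' \<and> D = D'" using recover[of B D] recover[of B' D'] * eq by metis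
    qed
    show "(\<lambda>(B, D). D \<union> ?E B) ` (SIGMA B:?I. ?S B) = ?C"
    proof (intro equalityI subsetI)
      fix C assume "C \<in> (\<lambda>(B, D). D \<union> ?E B) ` (SIGMA B:?I. ?S B)"
      then obtain B D where C: "C = D \<union> ?E B" "B \<in> ?I" "D \<in> ?S B" by auto
      note D = S_sub[OF C(2,3)]
      have "card D = k - card B" using C(3) by (simp add: start_parts_def)
      then show "C \<in> ?C"
        using clique_split_iff[OF _ n D, of B] card_glue[of B D] C D by auto
    next
      fix C assume "C \<in> ?C"
      then have C: "C \<in> cliques n" "card C = k" "C \<subseteq> {1..n}" by (auto simp: cliques_def)
      define D where "D = C \<inter> {1..n - r}"
      define B where "B = (\<lambda>x. n - x) ` (C - {1..n - r})"
      have DB: "D \<subseteq> {1..n - r}" "B \<subseteq> {..<r}" using C(3) n by (auto simp: D_def B_def)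
      have "?E B = C - {1..n - r}" unfolding B_def image_image using C(3) by force
      then have CDB: "C = D \<union> ?E B" by (auto simp: D_def)
      have "end_part_clique B" "D \<in> start_parts B (n - margin B) (card D)"
        using clique_split_iff[OF DB(2) n DB(1)] C(1) CDB by auto
      moreover have "k = card D + card B" using card_glue[OF DB(2,1)] CDB C(2) by simp
      ultimately have "(B, D) \<in> (SIGMA B:?I. ?S B)" using DB by simp
      then show "C \<in> (\<lambda>(B, D). D \<union> ?E B) ` (SIGMA B:?I. ?S B)" using CDB by force
    qed
  qed
  then have "card ?C = card (SIGMA B:?I. ?S B)" by (simp add: bij_betw_same_card)
  also have "\<dots> = (\<Sum>B\<in>?I. card (?S B))"
    by (rule card_SigmaI) (auto intro: finite_start_parts)
  finally show ?thesis by (simp add: face_count_def)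
qed

text \<open>
  Every end part \<open>B\<close> with at most \<open>k\<close> elements contributes by the recurrence for start parts. An end
  part with exactly \<open>k + 1\<close> elements is a whole clique; it is counted once on each side and occurs only
  in the first summand on the right.
\<close>

lemma clique_count_Suc:
  assumes n: "4 * r + s \<le> n"
  shows "face_count (cliques n) (Suc k) =
    face_count (cliques (n - 1)) (Suc k) + face_count (cliques (n - s)) k"
proof -
  let ?I = "\<lambda>k. {B \<in> Pow {..<r}. end_part_clique B \<and> card B \<le> k}"
  let ?c = "\<lambda>m k B. card (start_parts B (m - margin B) (k - card B))"
  have s_le: "s \<le> r" using gap_attained bounds by fastforce
  \<comment> \<open>\<open>margin B \<le> 2 * r\<close>, so \<open>n - margin B \<ge> 2 * r + s\<close> and the recurrence for start parts applies.\<close>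
  have small: "?c n (Suc k) B = ?c (n - 1) (Suc k) B + ?c (n - s) k B" if "B \<in> ?I k" for B
  proof -
    have "margin B \<le> 2 * r" using margin_le that by auto
    then have "card (start_parts B (n - margin B) (Suc (k - card B))) =
      card (start_parts B (n - margin B - 1) (Suc (k - card B))) +
      card (start_parts B (n - margin B - s) (k - card B))"
      using n by (intro card_start_parts_Suc) auto
    then show ?thesis using that by (simp add: Suc_diff_le add.commute)
  qed
  have large: "?c n (Suc k) B = ?c (n - 1) (Suc k) B" if "B \<in> ?I (Suc k) - ?I k" for B
  proof -
    have "Suc k - card B = 0" using that by auto
    then show ?thesis by (simp only: start_parts_0)
  qed
  have fin: "finite (?I (Suc k))" by simp
  have sub: "?I k \<subseteq> ?I (Suc k)" by auto
  have "face_count (cliques n) (Suc k) = (\<Sum>B\<in>?I (Suc k). ?c n (Suc k) B)"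
    using n by (intro clique_count_eq_sum) auto
  also have "\<dots> = (\<Sum>B\<in>?I (Suc k) - ?I k. ?c n (Suc k) B) + (\<Sum>B\<in>?I k. ?c n (Suc k) B)"
    by (rule sum.subset_diff[OF sub fin])
  also have "\<dots> = (\<Sum>B\<in>?I (Suc k) - ?I k. ?c (n - 1) (Suc k) B)
      + ((\<Sum>B\<in>?I k. ?c (n - 1) (Suc k) B) + (\<Sum>B\<in>?I k. ?c (n - s) k B))"
    using sum.cong[OF refl small, of "?I k"] sum.cong[OF refl large, of "?I (Suc k) - ?I k"]
    by (simp only: sum.distrib)
  also have "\<dots> = (\<Sum>B\<in>?I (Suc k). ?c (n - 1) (Suc k) B) + (\<Sum>B\<in>?I k. ?c (n - s) k B)"
    using sum.subset_diff[OF sub fin, of "?c (n - 1) (Suc k)"] by simp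
  also have "\<dots> = face_count (cliques (n - 1)) (Suc k) + face_count (cliques (n - s)) k"
    using n s_le s_pos bounds by (subst (1 2) clique_count_eq_sum) auto
  finally show ?thesis .
qed

text \<open>
  Clique members are at distance at least \<open>s\<close>, so they have distinct quotients by \<open>s\<close>.
\<close>

lemma card_clique_le:
  assumes "C \<in> cliques n"
  shows "card C \<le> n div s + 1"
proof -
  have C: "C \<subseteq> {1..n}" using assms by (simp add: cliques_def)
  have "i div s < j div s" if "i \<in> C" "j \<in> C" "i < j" for i j
  proof -
    have "i + s \<le> j" using adj_gap[of n i j] assms that by (auto simp: cliques_def)
    then have "(i + s) div s \<le> j div s" by (rule div_le_mono)
    then show ?thesis using s_pos by simp
  qed
  then have "inj_on (\<lambda>i. i div s) C" by (metis linorder_inj_onI' nat_neq_iff)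
  moreover have "(\<lambda>i. i div s) ` C \<subseteq> {..n div s}" using C by (auto intro!: div_le_mono)
  ultimately show ?thesis using card_inj_on_le[of "\<lambda>i. i div s" C "{..n div s}"] by simp
qed

end

section \<open>Staircase functions\<close>

text \<open>
  The defect \<open>e n = n div s + 1 - w n\<close> is nonnegative and cannot increase when \<open>n\<close> grows by \<open>s\<close>.
  Hence the sum of \<open>s\<close> consecutive defects is nonincreasing and eventually constant, which makes \<open>e\<close>
  eventually periodic: \<open>w (n + s) = w n + 1\<close>. As \<open>w\<close> is also nondecreasing, it grows in each period by a
  single jump, and \<open>n0\<close> is chosen at a jump.
\<close>

lemma recurrence_eventually_staircase:
  fixes w :: "nat \<Rightarrow> nat" and s N M :: nat
  assumes s: "1 \<le> s"
    and rec: "\<And>n. N \<le> n \<Longrightarrow> w n = max (w (n - 1)) (w (n - s) + 1)"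
    and bound: "\<And>n. w n \<le> n div s + 1"
  shows "\<exists>n0\<ge>M. w n0 = w (n0 - 1) + 1 \<and> (\<forall>n\<ge>n0. w n = w n0 + (n - n0) div s \<and> w n = w (n - s) + 1)"
proof -
  define e where "e n = n div s + 1 - w n" for n
  have w_e: "w n + e n = n div s + 1" for n using bound[of n] by (simp add: e_def)
  have e_step: "e (n + s) \<le> e n" if "N \<le> n" for n
  proof -
    have "w (n + s) \<ge> w n + 1" using rec[of "n + s"] that by simp
    moreover have "(n + s) div s = n div s + 1" using s by simp
    ultimately show ?thesis using w_e[of n] w_e[of "n + s"] by linarith
  qed
  define E where "E n = (\<Sum>j<s. e (n + j))" for n
  \<comment> \<open>Shifting the window by one exchanges its first member for the one \<open>s\<close> later.\<close>
  have E_Suc: "E (Suc n) + e n = E n + e (n + s)" for n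
  proof -
    have "(\<Sum>j<Suc s. e (n + j)) = E n + e (n + s)" by (simp add: E_def)
    moreover have "(\<Sum>j<Suc s. e (n + j)) = e n + E (Suc n)"
      by (subst sum.lessThan_Suc_shift) (simp add: E_def)
    ultimately show ?thesis by simp
  qed
  obtain m where m: "N \<le> m" "\<And>k. N \<le> k \<Longrightarrow> E m \<le> E k"
    using ex_has_least_nat[of "\<lambda>n. N \<le> n" N E] by auto
  have E_le: "E n \<le> E m" if "m \<le> n" for n
    using that
  proof (induction n rule: dec_induct)
    case base
    then show ?case by simp
  next
    case (step n)
    then show ?case using E_Suc[of n] e_step[of n] m(1) by simp
  qed
  have per: "w (n + s) = w n + 1" if "m \<le> n" for n
  proof -
    have "E (Suc n) = E n" using E_le[of n] E_le[of "Suc n"] m(2)[of n] m(2)[of "Suc n"] that m(1) by simp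
    then have "e (n + s) = e n" using E_Suc[of n] by simp
    moreover have "(n + s) div s = n div s + 1" using s by simp
    ultimately show ?thesis using w_e[of n] w_e[of "n + s"] by linarith
  qed
  have mono: "w n \<le> w (n + k)" if "N \<le> n" for n k
  proof (induction k)
    case (Suc k)
    have "w (n + k) \<le> w (n + Suc k)" using rec[of "n + Suc k"] that by simp
    then show ?case using Suc by simp
  qed simp
  define m' where "m' = m + s + M"
  define n0 where "n0 = (LEAST n. m' < n \<and> w m' < w n)"
  have "m' < m' + s \<and> w m' < w (m' + s)" using per[of m'] s by (simp add: m'_def)
  then have n0: "m' < n0" "w m' < w n0"
    using LeastI[of "\<lambda>n. m' < n \<and> w m' < w n" "m' + s"] by (auto simp: n0_def)
  have prev: "w (n0 - 1) = w m'"
  proof -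
    have "\<not> (m' < n0 - 1 \<and> w m' < w (n0 - 1))"
      using not_less_Least[of "n0 - 1" "\<lambda>n. m' < n \<and> w m' < w n"] n0(1) by (simp add: n0_def)
    moreover have "w m' \<le> w (n0 - 1)" using mono[of m' "n0 - 1 - m'"] n0(1) m(1) by (simp add: m'_def)
    moreover have "m' = n0 - 1 \<or> m' < n0 - 1" using n0(1) by linarith
    ultimately show ?thesis by auto
  qed
  have flat: "w (n0 + t) = w (n0 - 1) + 1" if "t < s" for t
  proof -
    have "w n0 \<le> w (n0 + t)" using mono[of n0 t] n0(1) m(1) by (simp add: m'_def)
    moreover have "w (n0 + t) \<le> w (n0 + t + (s - 1 - t))" using n0(1) m(1) by (intro mono) (simp add: m'_def)
    moreover have "n0 + t + (s - 1 - t) = (n0 - 1) + s" using that n0(1) by simp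
    moreover have "w ((n0 - 1) + s) = w (n0 - 1) + 1" using n0(1) by (intro per) (simp add: m'_def)
    ultimately show ?thesis using prev n0(2) by simp
  qed
  have many: "w (n + q * s) = w n + q" if "m \<le> n" for n q
  proof (induction q)
    case (Suc q)
    then show ?case using per[of "n + q * s"] that by (simp add: algebra_simps)
  qed simp
  have "w n = w n0 + (n - n0) div s" if "n0 \<le> n" for n
  proof -
    have "n = n0 + (n - n0) mod s + (n - n0) div s * s" using that by simp
    then have "w n = w (n0 + (n - n0) mod s) + (n - n0) div s"
      using many[of "n0 + (n - n0) mod s" "(n - n0) div s"] n0(1) by (simp add: m'_def)
    then show ?thesis using flat[of "(n - n0) mod s"] flat[of 0] s by simp
  qed
  moreover have "w n = w (n - s) + 1" if "n0 \<le> n" for n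
    using per[of "n - s"] that n0(1) by (simp add: m'_def)
  moreover have "w n0 = w (n0 - 1) + 1" using flat[of 0] s by simp
  moreover have "M \<le> n0" using n0(1) by (simp add: m'_def)
  ultimately show ?thesis by blast
qed

lemma poly_eq_if_eq_infinitely_often:
  fixes p q :: "'a :: {idom, ring_char_0} poly"
  assumes "infinite {x. poly p x = poly q x}"
  shows "p = q"
proof (rule ccontr)
  assume "p \<noteq> q"
  then have "finite {x. poly (p - q) x = 0}" by (intro poly_roots_finite) simp
  then show False using assms by simp
qed

text \<open>
  On a residue class modulo \<open>s\<close> the remainder is constant, so the staircase is a polynomial of slope
  \<open>1 / s\<close> there.
\<close>

lemma staircase_residue:
  fixes c b :: int and n s :: nat
  assumes "1 \<le> s"
  shows "of_int (c + (int n - b) div int s) =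
    poly [: of_int c - of_int (b + (int n - b) mod int s) / of_nat s, 1 / of_nat s :] (of_nat n :: rat)"
proof -
  have "int n - b = (int n - b) div int s * int s + (int n - b) mod int s" by simp
  then have "(of_int (int n - b) :: rat) = of_int ((int n - b) div int s) * of_nat s + of_int ((int n - b) mod int s)"
    by (metis of_int_add of_int_mult of_int_of_nat_eq)
  then show ?thesis using assms by (simp add: field_simps)
qed

lemma staircase_qp_representation:
  fixes c b :: int and s :: nat
  assumes "1 \<le> s"
  shows "qp_representation (\<lambda>n. of_int (c + (int n - b) div int s)) s
    (\<lambda>k. [: of_int c - of_int (b + (int k - b) mod int s) / of_nat s, 1 / of_nat s :])"
  unfolding qp_representation_def
proof (intro conjI allI impI)
  fix n :: nat
  have "(int (n mod s) - b) mod int s = (int n - b) mod int s"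
    by (simp add: of_nat_mod mod_diff_left_eq)
  then show "of_int (c + (int n - b) div int s) =
    poly [: of_int c - of_int (b + (int (n mod s) - b) mod int s) / of_nat s, 1 / of_nat s :] (of_nat n :: rat)"
    using staircase_residue[OF assms] by simp
qed (use assms in simp)

text \<open>
  Along the multiples of \<open>N\<close> that are congruent to \<open>N\<close> modulo \<open>s * N\<close> the staircase is linear with slope
  \<open>1 / s\<close>, so the constituent polynomial \<open>P 0\<close> is that line. Its values at \<open>N\<close> and \<open>2 N\<close> differ by
  \<open>N / s\<close>, which has to be an integer.
\<close>

lemma staircase_quasiperiod_dvd:
  fixes c b :: int and s N :: nat
  assumes s: "1 \<le> s" and P: "qp_representation (\<lambda>n. of_int (c + (int n - b) div int s)) N P"
  shows "s dvd N"
proof -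
  define \<psi> :: "nat \<Rightarrow> int" where "\<psi> n = c + (int n - b) div int s" for n
  have P_eq: "of_int (\<psi> n) = poly (P (n mod N)) (of_nat n)" if "1 \<le> n" for n
    using P that by (auto simp: qp_representation_def \<psi>_def)
  have N: "1 \<le> N" using P by (simp add: qp_representation_def)
  have \<psi>_step: "\<psi> (k + q * s) = \<psi> k + int q" for k q
  proof -
    have "int (k + q * s) - b = (int k - b) + int q * int s" by simp
    moreover have "((int k - b) + int q * int s) div int s = int q + (int k - b) div int s"
      using s by (intro div_mult_self1) simp
    ultimately show ?thesis by (simp only: \<psi>_def)
  qed
  define L where "L = [: of_int (\<psi> N) - of_nat N / of_nat s, 1 / of_nat s :: rat :]"
  have "poly (P 0) (of_nat (N + q * s * N)) = poly L (of_nat (N + q * s * N))" for q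
  proof -
    have "(N + q * s * N) mod N = 0" by simp
    then have "poly (P 0) (of_nat (N + q * s * N)) = of_int (\<psi> (N + q * s * N))"
      using P_eq[of "N + q * s * N"] N by simp
    also have "\<psi> (N + q * s * N) = \<psi> N + int (q * N)" using \<psi>_step[of N "q * N"] by (simp add: ac_simps)
    also have "of_int (\<psi> N + int (q * N)) = poly L (of_nat (N + q * s * N))"
      using s by (simp add: L_def field_simps)
    finally show ?thesis .
  qed
  then have "range (\<lambda>q. of_nat (N + q * s * N)) \<subseteq> {x. poly (P 0) x = poly L x}" by blast
  moreover have "infinite (range (\<lambda>q. of_nat (N + q * s * N) :: rat))"
    using N s by (intro range_inj_infinite) (simp add: inj_def del: of_nat_add of_nat_mult)
  ultimately have "P 0 = L" by (intro poly_eq_if_eq_infinitely_often) (rule infinite_super)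
  then have "of_int (\<psi> (N + N)) = poly L (of_nat (N + N))" using P_eq[of "N + N"] N by simp
  also have "\<dots> = of_int (\<psi> N) + of_nat N / of_nat s" by (simp add: L_def field_simps)
  finally have "(of_nat N :: rat) / of_nat s = of_int (\<psi> (N + N) - \<psi> N)" by simp
  then have "(of_nat N :: rat) = of_int ((\<psi> (N + N) - \<psi> N) * int s)" using s by (simp add: field_simps)
  then have "int N = (\<psi> (N + N) - \<psi> N) * int s" by (metis of_int_eq_iff of_int_of_nat_eq)
  then have "int s dvd int N" by simp
  then show ?thesis by simp
qed

lemma staircase_quasi_linear_of_period:
  fixes c b :: int and s :: nat
  assumes s: "1 \<le> s"
  defines "\<psi> \<equiv> \<lambda>n. of_int (c + (int n - b) div int s)"
  shows "quasi_linear \<psi>" and "qp_period \<psi> = s"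
proof -
  define Q :: "nat \<Rightarrow> rat poly" where
    "Q k = [: of_int c - of_int (b + (int k - b) mod int s) / of_nat s, 1 / of_nat s :]" for k
  have rep: "qp_representation \<psi> s Q"
    unfolding \<psi>_def Q_def by (rule staircase_qp_representation[OF s])
  have "degree (Q k) = 1" for k using s by (simp add: Q_def)
  moreover have "0 \<in> {..<s}" using s by simp
  ultimately have "(\<lambda>k. degree (Q k)) ` {..<s} = {1}" by auto
  then have "(MAX k\<in>{..<s}. degree (Q k)) = 1" by simp
  then show "quasi_linear \<psi>" unfolding quasi_linear_def using rep by blast
  show "qp_period \<psi> = s"
    unfolding qp_period_def
  proof (rule Least_equality)
    show "\<exists>P. qp_representation \<psi> s P" using rep by blast
    show "s \<le> N" if ex: "\<exists>P. qp_representation \<psi> N P" for N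
    proof -
      obtain P where P: "qp_representation \<psi> N P" using ex by blast
      then have "s dvd N" unfolding \<psi>_def by (rule staircase_quasiperiod_dvd[OF s])
      moreover have "1 \<le> N" using P by (simp add: qp_representation_def)
      ultimately show ?thesis by (simp add: dvd_imp_le)
    qed
  qed
qed

section \<open>Invariant chains above the stability index\<close>

lemma chain_graph_above_stability:
  assumes chain: "Inc_invariant_chain G" and full: "vertices (G (stability_index G)) = {1..stability_index G}"
    and n: "stability_index G \<le> n"
  shows "vertices (G n) = {1..n}"
    and "i < j \<Longrightarrow> {i, j} \<in> edges (G n) \<longleftrightarrow>
      (\<exists>a b. a < b \<and> {a, b} \<in> edges (G (stability_index G)) \<and>
        a \<le> i \<and> i + b \<le> j + a \<and> j + stability_index G \<le> n + b)"
proof -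
  define r where "r = stability_index G"
  have r: "1 \<le> r" and orbit: "orbit_graph (Inc_between r n) (G r) = G n"
    using stability_index_orbit[OF chain] n by (auto simp: r_def)
  note graph = chain_graphD[OF chain r]
  show "vertices (G n) = {1..n}"
  proof
    show "vertices (G n) \<subseteq> {1..n}" using chain_graphD(2)[OF chain, of n] r n by (simp add: r_def)
    show "{1..n} \<subseteq> vertices (G n)"
    proof
      fix v assume v: "v \<in> {1..n}"
      \<comment> \<open>Vertex \<open>v\<close> comes from itself when \<open>v \<le> r\<close> and from the last vertex \<open>r\<close> otherwise.\<close>
      have "min v r \<in> vertices (G r)" using v r full by (simp add: r_def)
      moreover have "min v r \<le> v \<and> v + r \<le> n + min v r" using v n by (auto simp: r_def)
      ultimately show "v \<in> vertices (G n)"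
        using in_vertices_orbit_iff[OF graph(2), of v n] by (auto simp: orbit)
    qed
  qed
  show "{i, j} \<in> edges (G n) \<longleftrightarrow> (\<exists>a b. a < b \<and> {a, b} \<in> edges (G (stability_index G)) \<and>
        a \<le> i \<and> i + b \<le> j + a \<and> j + stability_index G \<le> n + b)" if "i < j"
    using in_edges_orbit_iff[OF graph that, of n] unfolding orbit unfolding r_def .
qed

lemma chain_edge_profile:
  assumes chain: "Inc_invariant_chain G" and full: "vertices (G (stability_index G)) = {1..stability_index G}"
    and touch: "{1, i} \<in> edges (G (stability_index G))" "{j, stability_index G} \<in> edges (G (stability_index G))"
  shows "edge_profile {(a, b). a < b \<and> {a, b} \<in> edges (G (stability_index G))}
    (stability_index G) (sparsity_index G)"
proof -
  define r where "r = stability_index G"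
  define T where "T = {(a, b). a < b \<and> {a, b} \<in> edges (G r)}"
  define D where "D = {j - i | i j. i < j \<and> {i, j} \<in> edges (G r)}"
  have r: "1 \<le> r" using stability_index_orbit(1)[OF chain] by (simp add: r_def)
  have edge: "a \<in> {1..r}" "b \<in> {1..r}" "a \<noteq> b" if "{a, b} \<in> edges (G r)" for a b
  proof -
    have "{a, b} \<subseteq> vertices (G r)" "card {a, b} = 2"
      using chain_graphD(1)[OF chain r] that by (auto simp: is_graph_def nsets_def)
    then show "a \<in> {1..r}" "b \<in> {1..r}" "a \<noteq> b" using full by (auto simp: r_def)
  qed
  have s: "sparsity_index G = Min D" by (simp add: sparsity_index_def D_def r_def)
  have "j - i \<le> r" if "{i, j} \<in> edges (G r)" for i j using edge(2)[OF that] unfolding atLeastAtMost_iff by linarith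
  then have "D \<subseteq> {..r}" by (auto simp: D_def)
  then have fin: "finite D" by (rule finite_subset) simp
  have first: "(1, i) \<in> T" using edge[of 1 i] touch by (auto simp: T_def r_def)
  have last: "(j, r) \<in> T" using edge[of j r] touch by (auto simp: T_def r_def)
  have ne: "D \<noteq> {}" using first by (auto simp: T_def D_def)
  have "Min D \<in> D" by (rule Min_in[OF fin ne])
  then obtain a b where ab: "Min D = b - a" "a < b" "{a, b} \<in> edges (G r)" by (auto simp: D_def)
  have "edge_profile T r (Min D)"
  proof
    fix a b assume T: "(a, b) \<in> T"
    then have "b - a \<in> D" by (auto simp: T_def D_def)
    then have "Min D \<le> b - a" by (rule Min_le[OF fin])
    then show "1 \<le> a \<and> a + Min D \<le> b \<and> b \<le> r" using edge[of a b] T by (auto simp: T_def)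
  next
    show "1 \<le> Min D" using ab by simp
    show "\<exists>p. (p, p + Min D) \<in> T" using ab by (intro exI[of _ a]) (simp add: T_def)
    show "\<exists>b. (1, b) \<in> T" "\<exists>a. (a, r) \<in> T" using first last by blast+
  qed
  then show ?thesis by (simp add: s T_def r_def)
qed

lemma (in edge_profile) clique_complex_eq_cliques:
  assumes "vertices H = {1..n}" "\<And>i j. i < j \<Longrightarrow> {i, j} \<in> edges H \<longleftrightarrow> adj n i j"
  shows "clique_complex H = cliques n"
proof -
  have "clique C (edges H) \<longleftrightarrow> (\<forall>i\<in>C. \<forall>j\<in>C. i < j \<longrightarrow> adj n i j)" for C
  proof -
    have "clique C (edges H) \<longleftrightarrow> (\<forall>i\<in>C. \<forall>j\<in>C. i < j \<longrightarrow> {i, j} \<in> edges H)"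
      unfolding clique_def by (metis insert_commute nat_neq_iff)
    then show ?thesis using assms(2) by simp
  qed
  then show ?thesis using assms(1) by (simp add: clique_complex_def cliques_def)
qed

lemma clique_number_eq_max_face_card: "clique_number H = max_face_card (clique_complex H)"
  by (simp add: clique_number_def max_face_card_def clique_complex_def setcompr_eq_image)

context edge_profile
begin

lemma finite_cliques: "finite (cliques n)"
  by (rule finite_subset[of _ "Pow {1..n}"]) (auto simp: cliques_def)

lemma empty_in_cliques: "{} \<in> cliques n"
  by (simp add: cliques_def)

lemma cliques_face_recurrence:
  assumes "4 * r + s \<le> n"
  shows "face_recurrence (cliques n) (cliques (n - 1)) (cliques (n - s))"
proof
  show "F \<in> cliques n \<union> cliques (n - 1) \<union> cliques (n - s) \<Longrightarrow> finite F" for F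
    by (auto simp: cliques_def intro: finite_subset)
  show "face_count (cliques n) (Suc k) = face_count (cliques (n - 1)) (Suc k) + face_count (cliques (n - s)) k" for k
    by (rule clique_count_Suc[OF assms])
qed (auto simp: finite_cliques empty_in_cliques)

lemma max_clique_card_staircase:
  "\<exists>n0\<ge>M. max_face_card (cliques n0) = max_face_card (cliques (n0 - 1)) + 1 \<and>
    (\<forall>n\<ge>n0. max_face_card (cliques n) = max_face_card (cliques n0) + (n - n0) div s \<and>
      max_face_card (cliques n) = max_face_card (cliques (n - s)) + 1)"
proof (rule recurrence_eventually_staircase[OF s_pos])
  fix n assume "4 * r + s \<le> n"
  then interpret face_recurrence "cliques n" "cliques (n - 1)" "cliques (n - s)"
    by (rule cliques_face_recurrence)
  show "max_face_card (cliques n) = max (max_face_card (cliques (n - 1))) (max_face_card (cliques (n - s)) + 1)"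
    by (rule max_face_card_eq)
next
  fix n
  show "max_face_card (cliques n) \<le> n div s + 1"
    unfolding max_face_card_def
    using finite_cliques[of n] empty_in_cliques[of n] card_clique_le[of _ n] by (subst Max_le_iff) auto
qed

end

theorem theorem5p1:
  fixes G :: "nat \<Rightarrow> ngraph" and r s :: nat
  assumes "Inc_invariant_chain G"
    and "stability_index G = r"
    and "sparsity_index G = s"
    and "vertices (G r) = {1..r}"
    and "\<exists>i\<in>{1..r}. \<exists>j\<in>{1..r}. {1, i} \<in> edges (G r) \<and> {j, r} \<in> edges (G r)"
  shows "\<exists>n0 \<ge> r + s.
    eventually_quasi_linear_of_period (\<lambda>n. of_nat (clique_number (G n))) s \<and>
    (\<forall>n\<ge>n0.
      int (clique_number (G n)) = int (clique_number (G n0)) + \<lfloor>of_nat (n - n0) / (of_nat s :: rat)\<rfloor> \<and>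
      (\<forall>i\<ge>0. f_number (clique_complex (G n)) i =
          f_number (clique_complex (G (n - 1))) i + f_number (clique_complex (G (n - s))) (i - 1)) \<and>
      (\<forall>i\<ge>0. h_number (clique_complex (G n)) i =
          (if \<not> s dvd (n - n0)
           then h_number (clique_complex (G (n - 1))) i + h_number (clique_complex (G (n - s))) (i - 1)
           else h_number (clique_complex (G (n - 1))) i - h_number (clique_complex (G (n - 1))) (i - 1)
                + h_number (clique_complex (G (n - s))) (i - 1))) \<and>
      euler_char (clique_complex (G n)) =
        euler_char (clique_complex (G (n - 1))) - euler_char (clique_complex (G (n - s))) + 1 \<and>
      reduced_euler_char (clique_complex (G n)) =
        reduced_euler_char (clique_complex (G (n - 1))) - reduced_euler_char (clique_complex (G (n - s))))"
proof -
  define T where "T = {(a, b). a < b \<and> {a, b} \<in> edges (G r)}"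
  obtain i j where touch: "{1, i} \<in> edges (G r)" "{j, r} \<in> edges (G r)" using assms(5) by blast
  interpret edge_profile T r s
    using chain_edge_profile[of G i j] assms touch by (simp add: T_def)
  have complex: "clique_complex (G n) = cliques n" if "r \<le> n" for n
  proof (rule clique_complex_eq_cliques)
    show "vertices (G n) = {1..n}"
      using chain_graph_above_stability(1)[of G n] assms that by simp
    show "{i, j} \<in> edges (G n) \<longleftrightarrow> adj n i j" if "i < j" for i j
    proof -
      have "adj n i j \<longleftrightarrow> (\<exists>a b. a < b \<and> {a, b} \<in> edges (G r) \<and> a \<le> i \<and> i + b \<le> j + a \<and> j + r \<le> n + b)"
        unfolding adj_def by (auto simp: T_def)
      then show ?thesis
        using chain_graph_above_stability(2)[of G n i j] assms(1,2,4) that \<open>r \<le> n\<close> by simp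
    qed
  qed
  have omega: "clique_number (G n) = max_face_card (cliques n)" if "r \<le> n" for n
    using complex[OF that] by (simp add: clique_number_eq_max_face_card)
  \<comment> \<open>The bound leaves room for the face recurrence at \<open>n0\<close>, including its term of index \<open>n0 - s\<close>.\<close>
  obtain n0 where n0: "4 * r + s + s \<le> n0"
    and jump: "max_face_card (cliques n0) = max_face_card (cliques (n0 - 1)) + 1"
    and stair: "\<And>n. n0 \<le> n \<Longrightarrow> max_face_card (cliques n) = max_face_card (cliques n0) + (n - n0) div s"
    and lag: "\<And>n. n0 \<le> n \<Longrightarrow> max_face_card (cliques n) = max_face_card (cliques (n - s)) + 1"
    using max_clique_card_staircase[of "4 * r + s + s"] by blast
  have "eventually_quasi_linear_of_period (\<lambda>n. of_nat (clique_number (G n))) s"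
  proof -
    define \<psi> :: "nat \<Rightarrow> rat" where
      "\<psi> = (\<lambda>n. of_int (int (max_face_card (cliques n0)) + (int n - int n0) div int s))"
    have "of_nat (clique_number (G n)) = \<psi> n" if "n0 \<le> n" for n
    proof -
      have "(int n - int n0) div int s = int ((n - n0) div s)"
        using that by (simp add: zdiv_int of_nat_diff)
      then show ?thesis using stair[OF that] omega[of n] that n0 by (simp add: \<psi>_def)
    qed
    then have "\<forall>\<^sub>F n in sequentially. of_nat (clique_number (G n)) = \<psi> n"
      unfolding eventually_sequentially by blast
    then show ?thesis
      unfolding eventually_quasi_linear_of_period_def
      using staircase_quasi_linear_of_period[OF s_pos, of "int (max_face_card (cliques n0))" "int n0"]
      by (intro exI[of _ \<psi>]) (simp add: \<psi>_def)
  qed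
  moreover have
      "int (clique_number (G n)) = int (clique_number (G n0)) + \<lfloor>of_nat (n - n0) / (of_nat s :: rat)\<rfloor> \<and>
      (\<forall>i\<ge>0. f_number (clique_complex (G n)) i =
          f_number (clique_complex (G (n - 1))) i + f_number (clique_complex (G (n - s))) (i - 1)) \<and>
      (\<forall>i\<ge>0. h_number (clique_complex (G n)) i =
          (if \<not> s dvd (n - n0)
           then h_number (clique_complex (G (n - 1))) i + h_number (clique_complex (G (n - s))) (i - 1)
           else h_number (clique_complex (G (n - 1))) i - h_number (clique_complex (G (n - 1))) (i - 1)
                + h_number (clique_complex (G (n - s))) (i - 1))) \<and>
      euler_char (clique_complex (G n)) =
        euler_char (clique_complex (G (n - 1))) - euler_char (clique_complex (G (n - s))) + 1 \<and>
      reduced_euler_char (clique_complex (G n)) =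
        reduced_euler_char (clique_complex (G (n - 1))) - reduced_euler_char (clique_complex (G (n - s)))"
    (is "?omega \<and> ?f \<and> ?h \<and> ?chi \<and> ?rchi") if n: "n0 \<le> n" for n
  proof -
    interpret face_recurrence "cliques n" "cliques (n - 1)" "cliques (n - s)"
      using n n0 by (intro cliques_face_recurrence) simp
    have r: "1 \<le> r" using touches_last bounds by fastforce
    have cx: "clique_complex (G n) = cliques n" "clique_complex (G (n - 1)) = cliques (n - 1)"
      "clique_complex (G (n - s)) = cliques (n - s)"
      using n n0 r by (auto intro!: complex)
    have ?omega
      using stair[OF n] omega[of n] omega[of n0] n n0 by (simp add: floor_divide_of_nat_eq del: of_nat_diff)
    moreover have ?f unfolding cx using f_number_eq by blast
    moreover have ?h
    proof (cases "s dvd n - n0")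
      case True
      have "max_face_card (cliques n) = max_face_card (cliques (n - 1)) + 1"
      proof (cases "n = n0")
        case True
        then show ?thesis using jump by simp
      next
        case False
        then have "n0 \<le> n - 1" "n - n0 = Suc (n - 1 - n0)" using n by auto
        moreover have "Suc (n - 1 - n0) div s = Suc ((n - 1 - n0) div s)"
          using True calculation(2) by (simp add: div_Suc dvd_eq_mod_eq_0)
        ultimately show ?thesis using stair[OF n] stair[of "n - 1"] by simp
      qed
      then show ?thesis unfolding cx using h_number_dim_jump lag[OF n] True by simp
    next
      case False
      then have "n \<noteq> n0" by auto
      then have "n0 \<le> n - 1" "n - n0 = Suc (n - 1 - n0)" using n by auto
      moreover have "Suc (n - 1 - n0) div s = (n - 1 - n0) div s"
        using False calculation(2) by (simp add: div_Suc dvd_eq_mod_eq_0)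
      ultimately have "max_face_card (cliques (n - 1)) = max_face_card (cliques n)"
        using stair[OF n] stair[of "n - 1"] by simp
      then show ?thesis unfolding cx using h_number_same_dim lag[OF n] False by simp
    qed
    moreover have ?rchi unfolding cx by (rule reduced_euler_char_eq_diff)
    moreover have ?chi unfolding cx using reduced_euler_char_eq_diff by (simp add: reduced_euler_char_def)
    ultimately show ?thesis by blast
  qed
  moreover have "r + s \<le> n0" using n0 by simp
  ultimately show ?thesis by blast
qed

end
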